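(* Let $N\ge 2$ and let $T:\mathcal{M}_N\to\mathcal{M}_N$ be a bistochastic channel such that $\hat T$ is strictly contractive with rate $C\in[0,1)$. Then: (i) $\hat T$ is ergodic, i.e. $X\in\mathcal{M}_N$ satisfies $\hat T(X)=X$ if and only if $X=\chi\mathbf{1}$ for some $\chi\in\mathbb{C}$; (ii) the spectrum of the operator $T\hat T=T\circ\hat T$ on $\mathcal{M}_N$ is contained in $[0,1-\gamma]\cup\{1\}$ for some $\gamma\ge 1-C$, i.e. every eigenvalue of $T\hat T$ other than $1$ lies in $[0,C]$; (iii) for every density matrix $\sigma\in\mathcal{D}_N$, $$S[\hat T(\sigma)]-S(\sigma)\ \ge\ \frac{1-C}{2}\,\big\|\sigma-N^{-1}\mathbf{1}\big\|_2^2 .$$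
   Context: $\mathcal{M}_N$ is the algebra of $N\times N$ complex matrices, $\mathbf{1}$ the identity matrix, $\mathcal{D}_N$ the set of $N\times N$ density matrices (positive semidefinite, trace one). A channel is a linear map $T:\mathcal{M}_N\to\mathcal{M}_N$ (Heisenberg picture) that is unital ($T(\mathbf{1})=\mathbf{1}$) and completely positive. Its Schrödinger-picture dual $\hat T$ is defined by $\mathrm{tr}[\hat T(A)B]=\mathrm{tr}[A\,T(B)]$ for all $A,B\in\mathcal{M}_N$; $\hat T$ is completely positive and trace preserving. $T$ is bistochastic if $T(\mathbf{1})=\hat T(\mathbf{1})=\mathbf{1}$. $\hat T$ is strictly contractive with rate $C\in[0,1)$ if $\|\hat T(\sigma)-\hat T(\sigma')\|_1\le C\|\sigma-\sigma'\|_1$ for all $\sigma,\sigma'\in\mathcal{D}_N$, where $\|A\|_1=\mathrm{tr}(A^*A)^{1/2}$ is the trace norm. $\|A\|_2=[\mathrm{tr}(A^*A)]^{1/2}$ is the Hilbert–Schmidt norm, and $S(\sigma)=-\mathrm{tr}(\sigma\ln\sigma)$ is the von Neumann entropy. $T\hat T$ is regarded as a linear operator on $\mathcal{M}_N$ equipped with the Hilbert–Schmidt inner product $\langle A,B\rangle=\mathrm{tr}(A^*B)$. *)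

theory Defs
  imports "Jordan_Normal_Form.Jordan_Normal_Form" "Jordan_Normal_Form.Schur_Decomposition"
begin

definition mtrace :: "complex mat \<Rightarrow> complex" where
  "mtrace A = (\<Sum>i<dim_row A. A $$ (i, i))"

definition psd :: "nat \<Rightarrow> complex mat \<Rightarrow> bool" where
  "psd n A \<longleftrightarrow> A \<in> carrier_mat n n \<and>
     (\<forall>v \<in> carrier_vec n. Im (conjugate v \<bullet> (A *\<^sub>v v)) = 0 \<and> Re (conjugate v \<bullet> (A *\<^sub>v v)) \<ge> 0)"

definition density :: "nat \<Rightarrow> complex mat set" where
  "density n = {\<sigma>. psd n \<sigma> \<and> mtrace \<sigma> = 1}"

text \<open>Functional calculus trace: tr f(A) = sum of f over eigenvalues counted with
  algebraic multiplicity (used for positive semidefinite A, whose eigenvalues are real).\<close>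
definition trace_fun :: "(real \<Rightarrow> real) \<Rightarrow> complex mat \<Rightarrow> real" where
  "trace_fun f A = (\<Sum>a \<in> {a. poly (char_poly A) a = 0}.
       real (Polynomial.order a (char_poly A)) * f (Re a))"

definition trace_norm :: "complex mat \<Rightarrow> real" where
  "trace_norm A = trace_fun sqrt (mat_adjoint A * A)"

definition hs_norm :: "complex mat \<Rightarrow> real" where
  "hs_norm A = sqrt (Re (mtrace (mat_adjoint A * A)))"

text \<open>von Neumann entropy  S(sigma) = - tr (sigma ln sigma), with 0 ln 0 = 0.\<close>
definition vn_entropy :: "complex mat \<Rightarrow> real" where
  "vn_entropy \<sigma> = - trace_fun (\<lambda>x. x * ln x) \<sigma>"

definition linear_map_on :: "nat \<Rightarrow> (complex mat \<Rightarrow> complex mat) \<Rightarrow> bool" where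
  "linear_map_on n T \<longleftrightarrow>
     (\<forall>A \<in> carrier_mat n n. T A \<in> carrier_mat n n) \<and>
     (\<forall>A \<in> carrier_mat n n. \<forall>B \<in> carrier_mat n n. T (A + B) = T A + T B) \<and>
     (\<forall>c. \<forall>A \<in> carrier_mat n n. T (c \<cdot>\<^sub>m A) = c \<cdot>\<^sub>m T A)"

text \<open>Block (i,j) (of size n x n) of a matrix in M_k(M_n) = M_{kn}.\<close>
definition mblock :: "nat \<Rightarrow> complex mat \<Rightarrow> nat \<Rightarrow> nat \<Rightarrow> complex mat" where
  "mblock n X i j = mat n n (\<lambda>(a, b). X $$ (i * n + a, j * n + b))"

text \<open>The ampliation id_k \<otimes> T acting on M_k(M_n).\<close>
definition ampliation :: "nat \<Rightarrow> nat \<Rightarrow> (complex mat \<Rightarrow> complex mat) \<Rightarrow> complex mat \<Rightarrow> complex mat" where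
  "ampliation k n T X = mat (k * n) (k * n)
     (\<lambda>(r, c). T (mblock n X (r div n) (c div n)) $$ (r mod n, c mod n))"

definition completely_positive :: "nat \<Rightarrow> (complex mat \<Rightarrow> complex mat) \<Rightarrow> bool" where
  "completely_positive n T \<longleftrightarrow>
     (\<forall>k. \<forall>X. psd (k * n) X \<longrightarrow> psd (k * n) (ampliation k n T X))"

text \<open>Channel (Heisenberg picture): linear, unital, completely positive.\<close>
definition channel :: "nat \<Rightarrow> (complex mat \<Rightarrow> complex mat) \<Rightarrow> bool" where
  "channel n T \<longleftrightarrow> linear_map_on n T \<and> T (1\<^sub>m n) = 1\<^sub>m n \<and> completely_positive n T"

definition is_dual :: "nat \<Rightarrow> (complex mat \<Rightarrow> complex mat) \<Rightarrow> (complex mat \<Rightarrow> complex mat) \<Rightarrow> bool" where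
  "is_dual n T Th \<longleftrightarrow> (\<forall>A \<in> carrier_mat n n. Th A \<in> carrier_mat n n) \<and>
     (\<forall>A \<in> carrier_mat n n. \<forall>B \<in> carrier_mat n n. mtrace (Th A * B) = mtrace (A * T B))"

definition strictly_contractive :: "nat \<Rightarrow> (complex mat \<Rightarrow> complex mat) \<Rightarrow> real \<Rightarrow> bool" where
  "strictly_contractive n Th C \<longleftrightarrow> 0 \<le> C \<and> C < 1 \<and>
     (\<forall>\<sigma> \<in> density n. \<forall>\<sigma>' \<in> density n.
        trace_norm (Th \<sigma> - Th \<sigma>') \<le> C * trace_norm (\<sigma> - \<sigma>'))"

definition op_eigenvalue :: "nat \<Rightarrow> (complex mat \<Rightarrow> complex mat) \<Rightarrow> complex \<Rightarrow> bool" where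
  "op_eigenvalue n L \<mu> \<longleftrightarrow> (\<exists>X \<in> carrier_mat n n. X \<noteq> 0\<^sub>m n n \<and> L X = \<mu> \<cdot>\<^sub>m X)"

end

theory Submission
  imports Defs "Jordan_Normal_Form.Spectral_Radius" "HOL-Analysis.Convex"
begin

text \<open>
  All three claims follow from \<open>\<parallel>Th X\<parallel>\<^sub>2\<^sup>2 \<le> C \<parallel>X\<parallel>\<^sub>2\<^sup>2\<close> for traceless \<open>X\<close>. The map \<open>\<Lambda> = T \<circ> Th\<close> is
  self-adjoint for the Hilbert-Schmidt product, so by Cauchy-Schwarz the numbers \<open>\<parallel>\<Lambda>\<^sup>k X\<parallel>\<^sub>2\<close> are
  log-convex in \<open>k\<close>; on the other hand they are \<open>O(C\<^sup>k)\<close>, because \<open>\<parallel>A\<parallel>\<^sub>2 \<le> \<parallel>A\<parallel>\<^sub>1\<close> for Hermitian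
  \<open>A\<close> and \<open>Th\<close> contracts the trace norm of traceless ones, while \<open>T\<close> does not increase it. A
  log-convex sequence that is \<open>O(C\<^sup>k)\<close> decreases by the factor \<open>C\<close> already in its first step,
  whence \<open>\<parallel>Th X\<parallel>\<^sub>2\<^sup>2 = \<langle>X, \<Lambda> X\<rangle> \<le> \<parallel>X\<parallel>\<^sub>2 \<parallel>\<Lambda> X\<parallel>\<^sub>2 \<le> C \<parallel>X\<parallel>\<^sub>2\<^sup>2\<close>.

  The spectrum of \<open>Th A\<close> arises from that of a Hermitian \<open>A\<close> by a doubly stochastic matrix, so
  \<open>tr f (Th A) \<le> tr f A\<close> for every convex \<open>f\<close>. For \<open>f x = \<bar>x\<bar>\<close> this is the monotonicity of the
  trace norm; for \<open>f x = x ln x - (x - 1/N)\<^sup>2 / 2\<close>, which is convex on \<open>[0, 1]\<close>, it says that the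
  entropy gain is at least half of \<open>\<parallel>\<sigma> - \<one>/N\<parallel>\<^sub>2\<^sup>2 - \<parallel>Th \<sigma> - \<one>/N\<parallel>\<^sub>2\<^sup>2\<close>, to which the estimate
  applies.
\<close>

section \<open>Log-convex sequences and convex functions\<close>

lemma le_if_power_le_geometric:
  fixes x y K :: real
  assumes y: "0 \<le> y" and bound: "\<And>k. x ^ k \<le> K * y ^ k"
  shows "x \<le> y"
proof (cases "y = 0")
  case True
  with bound[of 1] show ?thesis by simp
next
  case False
  show ?thesis
  proof (rule ccontr)
    assume "\<not> x \<le> y"
    with y False have "1 < x / y" by simp
    then obtain k where "K < (x / y) ^ k" using real_arch_pow by blast
    moreover have "(x / y) ^ k \<le> K"
      using bound[of k] y False by (simp add: power_divide field_simps)
    ultimately show False by simp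
  qed
qed

lemma log_convex_ratio_mono:
  fixes h :: "nat \<Rightarrow> real"
  assumes nonneg: "\<And>k. 0 \<le> h k" and log_convex: "\<And>k. (h (Suc k))\<^sup>2 \<le> h k * h (Suc (Suc k))"
  shows "h 1 * h k \<le> h 0 * h (Suc k)"
proof (induction k)
  case (Suc k)
  show ?case
  proof (cases "h (Suc k) = 0")
    case False
    with nonneg[of "Suc k"] have pos: "0 < h (Suc k)" by simp
    have "h (Suc k) * (h 1 * h (Suc k)) = h 1 * (h (Suc k))\<^sup>2" by (simp add: power2_eq_square)
    also have "\<dots> \<le> h 1 * (h k * h (Suc (Suc k)))"
      by (intro mult_left_mono log_convex nonneg)
    also have "\<dots> = h 1 * h k * h (Suc (Suc k))" by simp
    also have "\<dots> \<le> h 0 * h (Suc k) * h (Suc (Suc k))"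
      by (intro mult_right_mono Suc nonneg)
    also have "\<dots> = h (Suc k) * (h 0 * h (Suc (Suc k)))" by simp
    finally show ?thesis using pos by simp
  qed (simp add: nonneg)
qed (simp add: mult.commute)

lemma log_convex_geometric_bound:
  fixes h :: "nat \<Rightarrow> real"
  assumes nonneg: "\<And>k. 0 \<le> h k" and log_convex: "\<And>k. (h (Suc k))\<^sup>2 \<le> h k * h (Suc (Suc k))"
    and bound: "\<And>k. h k \<le> K * C ^ k" and C: "0 \<le> C"
  shows "h 1 \<le> C * h 0"
proof (cases "h 0 = 0")
  case True
  with log_convex[of 0] show ?thesis by simp
next
  case False
  with nonneg[of 0] have h0: "0 < h 0" by simp
  have power_bound: "h 1 ^ k * h 0 \<le> h 0 ^ k * h k" for k
  proof (induction k)
    case (Suc k)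
    have "h 1 ^ Suc k * h 0 = h 1 * (h 1 ^ k * h 0)" by simp
    also have "\<dots> \<le> h 1 * (h 0 ^ k * h k)" by (intro mult_left_mono Suc nonneg)
    also have "\<dots> = h 0 ^ k * (h 1 * h k)" by simp
    also have "\<dots> \<le> h 0 ^ k * (h 0 * h (Suc k))"
      by (intro mult_left_mono log_convex_ratio_mono log_convex zero_le_power nonneg)
    finally show ?case by (simp add: mult_ac)
  qed simp
  show ?thesis
  proof (rule le_if_power_le_geometric)
    fix k
    have "h 0 ^ k * h k \<le> h 0 ^ k * (K * C ^ k)"
      by (intro mult_left_mono bound zero_le_power nonneg)
    with power_bound[of k] have "h 1 ^ k * h 0 \<le> K * (C * h 0) ^ k"
      by (simp add: power_mult_distrib mult_ac)
    thus "h 1 ^ k \<le> K / h 0 * (C * h 0) ^ k" using h0 by (simp add: field_simps)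
  qed (use C h0 in simp)
qed

lemma convex_on_xlnx_minus_half_square:
  fixes c :: real
  shows "convex_on {0..1} (\<lambda>x. x * ln x - (x - c)\<^sup>2 / 2)" (is "convex_on _ ?f")
proof (rule convex_on_linorderI)
  fix t x y :: real
  assume t: "0 < t" "t < 1" and xy: "x \<in> {0..1}" "y \<in> {0..1}" "x < y"
  \<comment> \<open>The second derivative \<open>1 / z - 1\<close> decides convexity only away from \<open>0\<close>, where \<open>ln\<close> is singular;
    with the endpoint \<open>x = 0\<close> the claim reduces to \<open>ln t \<le> (t - 1) * y / 2\<close>.\<close>
  have interior: "convex_on {0<..1} ?f"
  proof (rule f''_ge0_imp_convex)
    fix z :: real assume z: "z \<in> {0<..1}"
    show "(?f has_real_derivative ln z + 1 - (z - c)) (at z)"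
      using z by (auto intro!: derivative_eq_intros simp: field_simps)
    show "((\<lambda>z. ln z + 1 - (z - c)) has_real_derivative 1 / z - 1) (at z)"
      using z by (auto intro!: derivative_eq_intros)
    show "0 \<le> 1 / z - 1" using z by simp
  qed simp
  show "?f ((1 - t) *\<^sub>R x + t *\<^sub>R y) \<le> (1 - t) * ?f x + t * ?f y"
  proof (cases "x = 0")
    case True
    have "ln t \<le> t - 1" using t by (intro ln_le_minus_one) simp
    also have "\<dots> \<le> (t - 1) * (y / 2)"
      using t xy mult_left_mono_neg[of "y / 2" 1 "t - 1"] by simp
    finally have "t * y * ln t \<le> t * y * ((t - 1) * (y / 2))"
      using t xy by (intro mult_left_mono) auto
    moreover have "ln (t * y) = ln t + ln y" using t xy True by (simp add: ln_mult)
    ultimately show ?thesis using True by (simp add: power2_eq_square field_simps)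
  next
    case False
    with t xy convex_onD[OF interior, of t x y] show ?thesis by simp
  qed
qed simp

definition doubly_stochastic :: "'a set \<Rightarrow> ('a \<Rightarrow> 'a \<Rightarrow> real) \<Rightarrow> bool" where
  "doubly_stochastic I D \<longleftrightarrow> (\<forall>j\<in>I. \<forall>i\<in>I. 0 \<le> D j i) \<and>
     (\<forall>j\<in>I. (\<Sum>i\<in>I. D j i) = 1) \<and> (\<forall>i\<in>I. (\<Sum>j\<in>I. D j i) = 1)"

lemma sum_convex_doubly_stochastic_le:
  fixes p q :: "'a \<Rightarrow> real"
  assumes f: "convex_on S f" and D: "doubly_stochastic I D" and "finite I"
    and p: "\<And>i. i \<in> I \<Longrightarrow> p i \<in> S" and q: "\<And>j. j \<in> I \<Longrightarrow> q j = (\<Sum>i\<in>I. D j i * p i)"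
  shows "(\<Sum>j\<in>I. f (q j)) \<le> (\<Sum>i\<in>I. f (p i))"
proof -
  have "f (q j) \<le> (\<Sum>i\<in>I. D j i * f (p i))" if j: "j \<in> I" for j
  proof -
    have "f (\<Sum>i\<in>I. D j i *\<^sub>R p i) \<le> (\<Sum>i\<in>I. D j i * f (p i))"
      using \<open>finite I\<close> j f D p by (intro convex_on_sum) (auto simp: doubly_stochastic_def)
    thus ?thesis using q[OF j] by simp
  qed
  hence "(\<Sum>j\<in>I. f (q j)) \<le> (\<Sum>j\<in>I. \<Sum>i\<in>I. D j i * f (p i))" by (rule sum_mono)
  also have "\<dots> = (\<Sum>i\<in>I. (\<Sum>j\<in>I. D j i) * f (p i))"
    by (subst sum.swap) (simp add: sum_distrib_right)
  also have "\<dots> = (\<Sum>i\<in>I. f (p i))" using D by (simp add: doubly_stochastic_def)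
  finally show ?thesis .
qed

section \<open>Adjoints, Hermitian and unitary matrices\<close>

lemma dim_mat_adjoint [simp]:
  "dim_row (mat_adjoint A) = dim_col A" "dim_col (mat_adjoint A) = dim_row A"
  unfolding mat_adjoint_def by auto

lemma mat_adjoint_carrier [simp]:
  "A \<in> carrier_mat m n \<Longrightarrow> mat_adjoint A \<in> carrier_mat n m"
  unfolding carrier_mat_def by simp

lemma index_mat_adjoint [simp]:
  "i < dim_col A \<Longrightarrow> j < dim_row A \<Longrightarrow> mat_adjoint A $$ (i, j) = conjugate (A $$ (j, i))"
  unfolding mat_adjoint_def by (simp add: mat_of_rows_index)



lemma mat_adjoint_adjoint [simp]: "mat_adjoint (mat_adjoint A) = A"
  by (rule eq_matI) auto

lemma mat_adjoint_add:
  assumes "A \<in> carrier_mat m n" "B \<in> carrier_mat m n"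
  shows "mat_adjoint (A + B) = mat_adjoint A + mat_adjoint B"
  using assms by (intro eq_matI) (auto simp: conjugate_dist_add)

lemma mat_adjoint_minus:
  assumes "A \<in> carrier_mat m n" "B \<in> carrier_mat m n"
  shows "mat_adjoint (A - B) = mat_adjoint A - mat_adjoint B"
proof -
  have "conjugate (a - b) = conjugate a - conjugate b" for a b :: 'a
    using conjugate_dist_add[of a "- b"] by (simp add: conjugate_neg)
  with assms show ?thesis by (intro eq_matI) auto
qed

lemma mat_adjoint_smult: "mat_adjoint (c \<cdot>\<^sub>m A) = conjugate c \<cdot>\<^sub>m mat_adjoint A"
  by (rule eq_matI) (auto simp: conjugate_dist_mul)

lemma mat_adjoint_one [simp]: "mat_adjoint (1\<^sub>m n) = (1\<^sub>m n :: complex mat)"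
  by (rule eq_matI) auto

lemma mat_adjoint_mult:
  assumes "A \<in> carrier_mat m n" "B \<in> carrier_mat n p"
  shows "mat_adjoint (A * B) = mat_adjoint B * mat_adjoint A"
  using assms
  by (intro eq_matI)
    (auto simp: scalar_prod_def sum_conjugate conjugate_dist_mul mult.commute intro!: sum.cong)

definition hermitian_mat :: "nat \<Rightarrow> complex mat \<Rightarrow> bool" where
  "hermitian_mat n A \<longleftrightarrow> A \<in> carrier_mat n n \<and> mat_adjoint A = A"

definition unitary_mat :: "nat \<Rightarrow> complex mat \<Rightarrow> bool" where
  "unitary_mat n U \<longleftrightarrow> U \<in> carrier_mat n n \<and> mat_adjoint U * U = 1\<^sub>m n"

lemma unitary_matD:
  assumes "unitary_mat n U"
  shows "U \<in> carrier_mat n n" "mat_adjoint U \<in> carrier_mat n n"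
    "mat_adjoint U * U = 1\<^sub>m n" "U * mat_adjoint U = 1\<^sub>m n"
  using assms mat_mult_left_right_inverse[of "mat_adjoint U" n U] by (auto simp: unitary_mat_def)

lemma hermitian_matD:
  assumes "hermitian_mat n A"
  shows "A \<in> carrier_mat n n" "mat_adjoint A = A"
  using assms by (auto simp: hermitian_mat_def)

locale matrix_algebra =
  fixes n :: nat
begin

abbreviation \<M> :: "complex mat set" where
  "\<M> \<equiv> carrier_mat n n"

lemmas square_mat_simps [simp] = minus_carrier_mat mult_carrier_mat[of _ n n _ n]
  left_mult_one_mat[of _ n n] right_mult_one_mat[of _ n n]

lemmas mult_assoc = assoc_mult_mat[of _ n n _ n _ n]

lemmas adjoint_mult = mat_adjoint_mult[of _ n n _ n]

lemma unitary_mat_mult: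
  assumes "unitary_mat n U" "unitary_mat n V"
  shows "unitary_mat n (U * V)"
proof -
  note U = unitary_matD[OF assms(1)] and V = unitary_matD[OF assms(2)]
  have "mat_adjoint (U * V) * (U * V) = mat_adjoint V * (mat_adjoint U * (U * V))"
    using U(1,2) V(1,2) by (simp add: adjoint_mult mult_assoc)
  also have "mat_adjoint U * (U * V) = mat_adjoint U * U * V"
    using U(1,2) V(1) by (intro mult_assoc[symmetric])
  finally show ?thesis using U V by (simp add: unitary_mat_def)
qed

end

section \<open>Unitary triangularization\<close>

lemma normalized_corthogonal_unitary:
  fixes ws :: "complex vec list"
  assumes ws: "set ws \<subseteq> carrier_vec n" "corthogonal ws" "length ws = n"
  defines "r \<equiv> \<lambda>j. sqrt (Re (ws ! j \<bullet>c ws ! j))"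
  shows "unitary_mat n (mat n n (\<lambda>(i, j). ws ! j $ i / complex_of_real (r j)))"
    (is "unitary_mat n ?W")
proof -
  have carrier: "ws ! j \<in> carrier_vec n" if "j < n" for j using ws that by (metis nth_mem subsetD)
  have norm: "ws ! j \<bullet>c ws ! j = complex_of_real (r j) * complex_of_real (r j)" "r j \<noteq> 0"
    if "j < n" for j
  proof -
    have "0 < ws ! j \<bullet>c ws ! j"
      using corthogonalD[OF ws(2), of j j] conjugate_square_ge_0_vec[of "ws ! j"] that ws(3)
      by (simp add: less_le)
    thus "ws ! j \<bullet>c ws ! j = complex_of_real (r j) * complex_of_real (r j)" "r j \<noteq> 0"
      by (auto simp: r_def less_complex_def complex_eq_iff)
  qed
  have "mat_adjoint ?W * ?W = 1\<^sub>m n"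
  proof (rule eq_matI)
    fix j k assume "j < dim_row (1\<^sub>m n :: complex mat)" "k < dim_col (1\<^sub>m n :: complex mat)"
    hence jk: "j < n" "k < n" by auto
    have "(mat_adjoint ?W * ?W) $$ (j, k)
        = (\<Sum>i = 0..<n. ws ! k $ i * cnj (ws ! j $ i)) / (r j * r k)"
      using jk by (simp add: scalar_prod_def sum_divide_distrib mult.commute)
    also have "(\<Sum>i = 0..<n. ws ! k $ i * cnj (ws ! j $ i)) = ws ! k \<bullet>c ws ! j"
      using carrier[OF jk(1)] carrier[OF jk(2)] by (simp add: scalar_prod_def)
    also have "\<dots> / (r j * r k) = (if j = k then 1 else 0)"
      using corthogonalD[OF ws(2), of k j] jk ws(3) norm by auto
    finally show "(mat_adjoint ?W * ?W) $$ (j, k) = 1\<^sub>m n $$ (j, k)" using jk by simp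
  qed auto
  thus ?thesis by (simp add: unitary_mat_def)
qed

lemma unitary_completion:
  fixes v :: "complex vec"
  assumes v: "v \<in> carrier_vec n" and v0: "v \<noteq> 0\<^sub>v n"
  obtains W c where "unitary_mat n W" "col W 0 = c \<cdot>\<^sub>v v"
proof -
  interpret cof_vec_space n "TYPE(complex)" .
  define basis where "basis = basis_completion v"
  define ws where "ws = gram_schmidt n basis"
  note basis = basis_completion[OF v v0, folded basis_def]
  note ws = gram_schmidt_result[OF basis(2,4,5) ws_def]
  have n: "n \<noteq> 0" using v v0 by (metis carrier_vecD vec_of_dim_0)
  with basis(6,7) obtain vs where "basis = v # vs" by (cases basis) auto
  hence ws_hd: "ws ! 0 = v"
    using gram_schmidt_hd[OF v, of vs] ws(4) basis(6) n
    unfolding ws_def by (metis hd_conv_nth length_0_conv)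
  define c where "c = 1 / complex_of_real (sqrt (Re (v \<bullet>c v)))"
  define W where "W = mat n n
    (\<lambda>(i, j). ws ! j $ i / complex_of_real (sqrt (Re (ws ! j \<bullet>c ws ! j))))"
  have "unitary_mat n W"
    unfolding W_def using normalized_corthogonal_unitary[OF ws(3,2)] ws(4) basis(6) by simp
  moreover have "col W 0 = c \<cdot>\<^sub>v v"
    using n v by (intro eq_vecI) (auto simp: W_def ws_hd c_def)
  ultimately show thesis by (rule that)
qed

lemma unitary_deflation:
  fixes A :: "complex mat"
  assumes A: "A \<in> carrier_mat (Suc m) (Suc m)"
  obtains W a r B where "unitary_mat (Suc m) W"
    "a \<in> carrier_mat 1 1" "r \<in> carrier_mat 1 m" "B \<in> carrier_mat m m"
    "mat_adjoint W * (A * W) = four_block_mat a r (0\<^sub>m m 1) B"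
proof -
  let ?n = "Suc m"
  obtain e v where v: "v \<in> carrier_vec ?n" "v \<noteq> 0\<^sub>v ?n" "A *\<^sub>v v = e \<cdot>\<^sub>v v"
    using spectrum_non_empty[OF A] A unfolding spectrum_def eigenvalue_def eigenvector_def by auto
  obtain W c where unitary: "unitary_mat ?n W" and col_W: "col W 0 = c \<cdot>\<^sub>v v"
    using unitary_completion[OF v(1,2)] by blast
  note W = unitary_matD[OF unitary]
  define A' where "A' = mat_adjoint W * (A * W)"
  have A': "A' \<in> carrier_mat ?n ?n" using A W(1,2) by (auto simp: A'_def)
  have col_AW: "col (A * W) 0 = e \<cdot>\<^sub>v col W 0"
  proof -
    have "col (A * W) 0 = A *\<^sub>v col W 0" using A W(1) by (intro eq_vecI) auto
    also have "\<dots> = c \<cdot>\<^sub>v (A *\<^sub>v v)" unfolding col_W using A v by (simp add: mult_mat_vec)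
    finally show ?thesis unfolding v col_W by (auto simp: smult_smult_assoc mult.commute)
  qed
  have col_A': "A' $$ (i, 0) = (if i = 0 then e else 0)" if "i < ?n" for i
  proof -
    have "A' $$ (i, 0) = e * (row (mat_adjoint W) i \<bullet> col W 0)"
      using A W(1,2) that by (simp add: A'_def col_AW)
    also have "row (mat_adjoint W) i \<bullet> col W 0 = (mat_adjoint W * W) $$ (i, 0)"
      using W(1,2) that by simp
    finally show ?thesis using that by (simp add: W(3))
  qed
  have "A' = four_block_mat (mat 1 1 (\<lambda>_. e)) (mat 1 m (\<lambda>(i, j). A' $$ (i, Suc j)))
      (0\<^sub>m m 1) (mat m m (\<lambda>(i, j). A' $$ (Suc i, Suc j)))"
    using A' by (intro eq_matI) (auto simp: col_A')
  thus thesis using unitary by (intro that[of W]) (auto simp: A'_def)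
qed

lemma four_block_mult_block_upper:
  assumes "a \<in> carrier_mat k k" "b \<in> carrier_mat k m" "D \<in> carrier_mat m m"
    and "a' \<in> carrier_mat k k" "b' \<in> carrier_mat k m" "D' \<in> carrier_mat m m"
  shows "four_block_mat a b (0\<^sub>m m k) D * four_block_mat a' b' (0\<^sub>m m k) D'
    = four_block_mat (a * a') (a * b' + b * D') (0\<^sub>m m k) (D * D')"
  using assms
  by (subst mult_four_block_mat[of _ k k _ m _ m _ _ k _ m]) (auto intro!: cong_four_block_mat)

definition one_direct_sum :: "complex mat \<Rightarrow> complex mat" where
  "one_direct_sum V = four_block_mat (1\<^sub>m 1) (0\<^sub>m 1 (dim_col V)) (0\<^sub>m (dim_row V) 1) V"

lemma mat_adjoint_one_direct_sum: "mat_adjoint (one_direct_sum V) = one_direct_sum (mat_adjoint V)"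
  by (rule eq_matI) (auto simp: one_direct_sum_def)

lemma unitary_one_direct_sum:
  assumes "unitary_mat m V"
  shows "unitary_mat (Suc m) (one_direct_sum V)"
proof -
  note V = unitary_matD[OF assms]
  have "one_direct_sum V \<in> carrier_mat (1 + m) (1 + m)"
    unfolding one_direct_sum_def using V(1) by (intro four_block_carrier_mat) auto
  moreover have "mat_adjoint (one_direct_sum V) * one_direct_sum V = 1\<^sub>m (1 + m)"
    unfolding mat_adjoint_one_direct_sum using V
    by (simp add: one_direct_sum_def four_block_mult_block_upper[of _ 1 _ m] del: One_nat_def)
  ultimately show ?thesis by (simp add: unitary_mat_def)
qed

theorem unitary_schur:
  fixes A :: "complex mat"
  assumes "A \<in> carrier_mat n n"
  shows "\<exists>U. unitary_mat n U \<and> upper_triangular (mat_adjoint U * (A * U))"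
  using assms
proof (induction n arbitrary: A)
  case 0
  have "unitary_mat 0 (1\<^sub>m 0)" by (simp add: unitary_mat_def)
  moreover have "upper_triangular (mat_adjoint (1\<^sub>m 0) * (A * 1\<^sub>m 0))"
    by (simp add: upper_triangular_def)
  ultimately show ?case by blast
next
  case (Suc m)
  interpret matrix_algebra "Suc m" .
  note A = \<open>A \<in> \<M>\<close>
  obtain W a r B where W: "unitary_mat (Suc m) W"
    and blocks: "a \<in> carrier_mat 1 1" "r \<in> carrier_mat 1 m" "B \<in> carrier_mat m m"
    and WAW: "mat_adjoint W * (A * W) = four_block_mat a r (0\<^sub>m m 1) B"
    using unitary_deflation[OF A] .
  obtain V where V: "unitary_mat m V" and upper: "upper_triangular (mat_adjoint V * (B * V))"
    using Suc.IH[OF blocks(3)] by blast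
  let ?V = "one_direct_sum V"
  have unitary: "unitary_mat (Suc m) (W * ?V)"
    by (rule unitary_mat_mult[OF W unitary_one_direct_sum[OF V]])
  have "mat_adjoint (W * ?V) * (A * (W * ?V)) = mat_adjoint ?V * ((mat_adjoint W * (A * W)) * ?V)"
    using A unitary_matD(1,2)[OF W] unitary_matD(1,2)[OF unitary_one_direct_sum[OF V]]
    by (simp add: adjoint_mult mult_assoc)
  also have "\<dots> = four_block_mat a (r * V) (0\<^sub>m m 1) (mat_adjoint V * (B * V))"
    unfolding WAW mat_adjoint_one_direct_sum using blocks unitary_matD(1,2)[OF V]
    by (simp add: one_direct_sum_def four_block_mult_block_upper[of _ 1 _ m]
        left_mult_one_mat[of _ 1 m] right_mult_one_mat[of _ 1 1] mult_carrier_mat[of _ m m]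
        mult_carrier_mat[of _ 1 m] del: One_nat_def)
  also have "upper_triangular \<dots>"
    using blocks unitary_matD(1,2)[OF V] upper
    by (intro upper_triangular_four_block) (auto simp: upper_triangular_def)
  finally show ?case using unitary by blast
qed

section \<open>The spectral theorem\<close>

definition unitary_diag :: "complex mat \<Rightarrow> (nat \<Rightarrow> real) \<Rightarrow> complex mat" where
  "unitary_diag U d = U * mat_diag (dim_col U) (\<lambda>i. complex_of_real (d i)) * mat_adjoint U"

context matrix_algebra
begin

lemma unitary_diag_carrier [simp]: "unitary_mat n U \<Longrightarrow> unitary_diag U d \<in> \<M>"
  by (auto simp: unitary_diag_def dest: unitary_matD)

lemma col_unitary_carrier [simp]: "unitary_mat n U \<Longrightarrow> col U i \<in> carrier_vec n"
  by (metis carrier_matD(1) col_dim unitary_matD(1))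

lemma index_unitary_diag:
  assumes "unitary_mat n U" "i < n" "j < n"
  shows "unitary_diag U d $$ (i, j) = (\<Sum>k<n. d k * (U $$ (i, k) * cnj (U $$ (j, k))))"
  using unitary_matD(1,2)[OF assms(1)] assms(2,3)
  by (simp add: unitary_diag_def mat_diag_mult_right[of _ n n] scalar_prod_def
      lessThan_atLeast0 mult_ac)

lemma hermitian_unitary_diag: "unitary_mat n U \<Longrightarrow> hermitian_mat n (unitary_diag U d)"
  unfolding hermitian_mat_def
  by (intro conjI eq_matI unitary_diag_carrier)
    (auto simp: index_unitary_diag carrier_matD[OF unitary_diag_carrier] intro!: sum.cong)

lemma unitary_diag_smult:
  assumes "unitary_mat n U"
  shows "complex_of_real c \<cdot>\<^sub>m unitary_diag U d = unitary_diag U (\<lambda>i. c * d i)"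
  using assms carrier_matD[OF unitary_diag_carrier[OF assms]]
  by (intro eq_matI) (simp_all add: index_unitary_diag sum_distrib_left mult_ac)

lemma unitary_diag_one:
  assumes "unitary_mat n U"
  shows "unitary_diag U (\<lambda>_. 1) = 1\<^sub>m n"
  using unitary_matD[OF assms] by (simp add: unitary_diag_def)

lemma unitary_diag_add_smult_one:
  assumes "unitary_mat n U"
  shows "unitary_diag U d + complex_of_real c \<cdot>\<^sub>m 1\<^sub>m n = unitary_diag U (\<lambda>i. d i + c)"
  unfolding unitary_diag_one[OF assms, symmetric] unitary_diag_smult[OF assms]
  using carrier_matD[OF unitary_diag_carrier[OF assms]]
  by (intro eq_matI) (simp_all add: index_unitary_diag[OF assms] sum.distrib algebra_simps)

lemma unitary_diag_mult:
  assumes "unitary_mat n U"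
  shows "unitary_diag U d * unitary_diag U e = unitary_diag U (\<lambda>i. d i * e i)"
proof -
  note U = unitary_matD[OF assms]
  let ?D = "mat_diag n (\<lambda>i. complex_of_real (d i))"
  let ?E = "mat_diag n (\<lambda>i. complex_of_real (e i))"
  have "unitary_diag U d * unitary_diag U e = U * ?D * ((mat_adjoint U * U) * (?E * mat_adjoint U))"
    using U(1,2) by (simp add: unitary_diag_def mult_assoc)
  also have "\<dots> = U * (?D * ?E) * mat_adjoint U"
    using U(1,2) by (simp add: U(3) mult_assoc del: mat_diag_diag)
  finally show ?thesis using U(1) by (simp add: unitary_diag_def)
qed

lemma hermitian_upper_triangular_eq_diag:
  assumes "hermitian_mat n B" and upper: "upper_triangular B"
  shows "B = mat_diag n (\<lambda>i. complex_of_real (Re (B $$ (i, i))))" (is "_ = ?D")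
proof (rule eq_matI)
  note B = hermitian_matD[OF assms(1)]
  fix i j assume "i < dim_row ?D" "j < dim_col ?D"
  hence ij: "i < n" "j < n" by (auto simp: mat_diag_def)
  have "B $$ (i, j) = cnj (B $$ (j, i))"
    using index_mat_adjoint[of i B j] ij B by auto
  moreover have "B $$ (k, l) = 0" if "k < n" "l < k" for k l
    using upper B(1) that by auto
  ultimately show "B $$ (i, j) = ?D $$ (i, j)"
    using ij by (cases i j rule: linorder_cases) (auto simp: mat_diag_def complex_eq_iff)
qed (use hermitian_matD(1)[OF assms(1)] in \<open>auto simp: mat_diag_def\<close>)

theorem spectral_theorem:
  assumes "hermitian_mat n A"
  obtains U d where "unitary_mat n U" "A = unitary_diag U d"
proof -
  note A = hermitian_matD[OF assms]
  obtain U where unitary: "unitary_mat n U" and upper: "upper_triangular (mat_adjoint U * (A * U))"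
    using unitary_schur[OF A(1)] by blast
  note U = unitary_matD[OF unitary]
  define B where "B = mat_adjoint U * (A * U)"
  have "hermitian_mat n B"
    using A U(1,2) by (simp add: hermitian_mat_def B_def adjoint_mult mult_assoc)
  hence B: "B = mat_diag n (\<lambda>i. complex_of_real (Re (B $$ (i, i))))"
    using upper unfolding B_def by (rule hermitian_upper_triangular_eq_diag)
  have "U * B * mat_adjoint U = (U * mat_adjoint U) * A * (U * mat_adjoint U)"
    using A U(1,2) by (simp add: B_def mult_assoc)
  also have "\<dots> = A" using A U(4) by simp
  finally have "A = unitary_diag U (\<lambda>i. Re (B $$ (i, i)))"
    unfolding unitary_diag_def using U(1) B by simp
  with unitary show thesis by (rule that)
qed

end

section \<open>Traces and quadratic forms\<close>

lemma minus_mat_eq_zero_imp_eq: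
  fixes A B :: "'a :: group_add mat"
  assumes "A \<in> carrier_mat m k" "B \<in> carrier_mat m k" "A - B = 0\<^sub>m m k"
  shows "A = B"
  using assms by (metis carrier_matD index_minus_mat(1) index_zero_mat(1) eq_iff_diff_eq_0 eq_matI)

lemma mtrace_mult_eq_sum:
  assumes "A \<in> carrier_mat m k" "B \<in> carrier_mat k m"
  shows "mtrace (A * B) = (\<Sum>i<m. \<Sum>j<k. A $$ (i, j) * B $$ (j, i))"
  using assms by (simp add: mtrace_def scalar_prod_def lessThan_atLeast0)

lemma mtrace_mult_comm:
  assumes "A \<in> carrier_mat m k" "B \<in> carrier_mat k m"
  shows "mtrace (A * B) = mtrace (B * A)"
  unfolding mtrace_mult_eq_sum[OF assms] mtrace_mult_eq_sum[OF assms(2,1)]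
  by (subst sum.swap) (simp add: mult.commute)

definition qform :: "complex mat \<Rightarrow> complex vec \<Rightarrow> complex" where
  "qform A v = conjugate v \<bullet> (A *\<^sub>v v)"

definition outer_prod :: "complex vec \<Rightarrow> complex mat" where
  "outer_prod v = mat (dim_vec v) (dim_vec v) (\<lambda>(i, j). v $ i * cnj (v $ j))"

context matrix_algebra
begin

lemma mtrace_add: "A \<in> \<M> \<Longrightarrow> B \<in> \<M> \<Longrightarrow> mtrace (A + B) = mtrace A + mtrace B"
  by (simp add: mtrace_def sum.distrib)

lemma mtrace_minus: "A \<in> \<M> \<Longrightarrow> B \<in> \<M> \<Longrightarrow> mtrace (A - B) = mtrace A - mtrace B"
  by (simp add: mtrace_def sum_subtractf)

lemma mtrace_smult: "A \<in> \<M> \<Longrightarrow> mtrace (c \<cdot>\<^sub>m A) = c * mtrace A"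
  by (simp add: mtrace_def sum_distrib_left)

lemma mtrace_one: "mtrace (1\<^sub>m n) = of_nat n"
  by (simp add: mtrace_def)

lemma mat_eq_if_mtrace_mult_eq:
  assumes X: "X \<in> \<M>" and Y: "Y \<in> \<M>"
    and eq: "\<And>B. B \<in> \<M> \<Longrightarrow> mtrace (X * B) = mtrace (Y * B)"
  shows "X = Y"
proof (rule eq_matI)
  fix i j assume ij: "i < dim_row Y" "j < dim_col Y"
  let ?E = "mat n n (\<lambda>(k, l). if k = j \<and> l = i then 1 else 0) :: complex mat"
  have "mtrace (Z * ?E) = Z $$ (i, j)" if Z: "Z \<in> \<M>" for Z
  proof -
    have "mtrace (Z * ?E) = (\<Sum>k<n. \<Sum>l<n. if l = j \<and> k = i then Z $$ (k, l) else 0)"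
      by (subst mtrace_mult_eq_sum[OF Z]) (auto intro!: sum.cong)
    also have "\<dots> = (\<Sum>k<n. if k = i then Z $$ (k, j) else 0)"
      using ij Y by (intro sum.cong) auto
    finally show ?thesis using ij Y by simp
  qed
  from this[OF X] this[OF Y] eq[of ?E] show "X $$ (i, j) = Y $$ (i, j)" by simp
qed (use X Y in auto)

lemma psd_iff_qform: "psd n A \<longleftrightarrow> A \<in> \<M> \<and> (\<forall>v \<in> carrier_vec n. 0 \<le> qform A v)"
  by (auto simp: psd_def qform_def less_eq_complex_def)

lemma qform_eq_sum:
  assumes "A \<in> \<M>" "v \<in> carrier_vec n"
  shows "qform A v = (\<Sum>i<n. \<Sum>j<n. A $$ (i, j) * (v $ j * cnj (v $ i)))"
  using assms by (simp add: qform_def scalar_prod_def sum_distrib_left lessThan_atLeast0 mult_ac)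

lemma qform_minus:
  assumes "A \<in> \<M>" "B \<in> \<M>" "v \<in> carrier_vec n"
  shows "qform (A - B) v = qform A v - qform B v"
  using assms by (simp add: qform_eq_sum sum_subtractf left_diff_distrib)

lemma qform_smult:
  assumes "A \<in> \<M>" "v \<in> carrier_vec n"
  shows "qform (c \<cdot>\<^sub>m A) v = c * qform A v"
  using assms by (simp add: qform_eq_sum sum_distrib_left mult_ac)

lemma qform_adjoint:
  assumes "A \<in> \<M>" "v \<in> carrier_vec n"
  shows "qform (mat_adjoint A) v = cnj (qform A v)"
  using assms by (simp add: qform_eq_sum mult_ac) (rule sum.swap)

lemma qform_col:
  assumes "A \<in> \<M>" "U \<in> \<M>" "i < n"
  shows "qform A (col U i) = (mat_adjoint U * (A * U)) $$ (i, i)"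
proof -
  have "row (mat_adjoint U) i = conjugate (col U i)" using assms by (intro eq_vecI) auto
  moreover have "col (A * U) i = A *\<^sub>v col U i" using assms by (intro eq_vecI) auto
  ultimately show ?thesis using assms by (simp add: qform_def)
qed

lemma outer_prod_carrier [simp]: "v \<in> carrier_vec n \<Longrightarrow> outer_prod v \<in> \<M>"
  by (auto simp: outer_prod_def)

lemma mtrace_mult_outer_prod:
  assumes "A \<in> \<M>" "v \<in> carrier_vec n"
  shows "mtrace (A * outer_prod v) = qform A v"
  using assms by (simp add: mtrace_mult_eq_sum qform_eq_sum outer_prod_def)

lemma qform_outer_prod:
  assumes "v \<in> carrier_vec n" "w \<in> carrier_vec n"
  shows "qform (outer_prod v) w = complex_of_real ((cmod (\<Sum>i<n. v $ i * cnj (w $ i)))\<^sup>2)"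
  unfolding complex_norm_square using assms
  by (simp add: qform_eq_sum outer_prod_def sum_product mult_ac)

lemma psd_outer_prod: "v \<in> carrier_vec n \<Longrightarrow> psd n (outer_prod v)"
  by (simp add: psd_iff_qform qform_outer_prod less_eq_complex_def)

lemma mtrace_unitary_diag_mult:
  assumes "unitary_mat n U" and B: "B \<in> \<M>"
  shows "mtrace (unitary_diag U d * B) = (\<Sum>i<n. d i * qform B (col U i))"
proof -
  note U = unitary_matD[OF assms(1)]
  let ?D = "mat_diag n (\<lambda>i. complex_of_real (d i))"
  have "mtrace (unitary_diag U d * B) = mtrace (U * (?D * (mat_adjoint U * B)))"
    using U(1,2) B by (simp add: unitary_diag_def mult_assoc)
  also have "\<dots> = mtrace ((?D * (mat_adjoint U * B)) * U)"
    using U(1,2) B by (intro mtrace_mult_comm[of _ n n]) auto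
  also have "(?D * (mat_adjoint U * B)) * U = ?D * (mat_adjoint U * (B * U))"
    using U(1,2) B by (simp add: mult_assoc)
  also have "mtrace \<dots> = (\<Sum>i<n. d i * qform B (col U i))"
    using U(1,2) B by (simp add: mat_diag_mult_left[of _ n n] mtrace_def qform_col)
  finally show ?thesis .
qed

lemma qform_unitary_diag:
  assumes "unitary_mat n U" and i: "i < n"
  shows "qform (unitary_diag U d) (col U i) = d i"
proof -
  note U = unitary_matD[OF assms(1)]
  let ?D = "mat_diag n (\<lambda>i. complex_of_real (d i))"
  have "mat_adjoint U * (unitary_diag U d * U) = (mat_adjoint U * U) * ?D * (mat_adjoint U * U)"
    using U(1,2) by (simp add: unitary_diag_def mult_assoc)
  also have "\<dots> = ?D" unfolding U(3) by simp
  finally show ?thesis using qform_col[OF unitary_diag_carrier[OF assms(1)] U(1) i, of d] i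
    by (simp add: mat_diag_def)
qed

lemma mtrace_eq_sum_qform:
  assumes "unitary_mat n U" "A \<in> \<M>"
  shows "mtrace A = (\<Sum>i<n. qform A (col U i))"
  using mtrace_unitary_diag_mult[OF assms, of "\<lambda>_. 1"] assms(2)
  by (simp add: unitary_diag_one[OF assms(1)])

lemma mtrace_unitary_diag:
  assumes "unitary_mat n U"
  shows "mtrace (unitary_diag U d) = complex_of_real (\<Sum>i<n. d i)"
  using mtrace_eq_sum_qform[OF assms unitary_diag_carrier[OF assms]] qform_unitary_diag[OF assms]
  by simp

lemma mtrace_outer_prod_col:
  assumes "unitary_mat n U" "i < n"
  shows "mtrace (outer_prod (col U i)) = 1"
proof -
  have "mtrace (outer_prod (col U i)) = qform (1\<^sub>m n) (col U i)"
    using mtrace_mult_outer_prod[of "1\<^sub>m n" "col U i"] assms(1)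
    by (simp add: left_mult_one_mat[OF outer_prod_carrier])
  also have "\<dots> = 1"
    using qform_unitary_diag[OF assms, of "\<lambda>_. 1"] by (simp add: unitary_diag_one assms(1))
  finally show ?thesis .
qed

section \<open>Positive semidefinite matrices\<close>

lemma psd_carrier: "psd n A \<Longrightarrow> A \<in> \<M>"
  by (simp add: psd_def)

lemma psd_unitary_diag_iff:
  assumes "unitary_mat n U"
  shows "psd n (unitary_diag U d) \<longleftrightarrow> (\<forall>i<n. 0 \<le> d i)"
proof
  assume psd: "psd n (unitary_diag U d)"
  show "\<forall>i<n. 0 \<le> d i"
  proof (intro allI impI)
    fix i assume "i < n"
    with psd have "0 \<le> complex_of_real (d i)"
      using assms by (simp add: psd_iff_qform flip: qform_unitary_diag)
    thus "0 \<le> d i" by (simp add: less_eq_complex_def)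
  qed
next
  assume d: "\<forall>i<n. 0 \<le> d i"
  have "0 \<le> qform (unitary_diag U d) v" if v: "v \<in> carrier_vec n" for v
  proof -
    have "qform (unitary_diag U d) v = (\<Sum>i<n. d i * qform (outer_prod v) (col U i))"
      using v assms by (simp add: mtrace_mult_outer_prod[symmetric] mtrace_unitary_diag_mult)
    moreover have "0 \<le> qform (outer_prod v) (col U i)" if "i < n" for i
      using psd_outer_prod[OF v] assms that by (simp add: psd_iff_qform)
    ultimately show ?thesis
      using d by (auto intro!: sum_nonneg mult_nonneg_nonneg simp: less_eq_complex_def)
  qed
  thus "psd n (unitary_diag U d)" using assms by (simp add: psd_iff_qform)
qed

lemma psd_smult: "psd n A \<Longrightarrow> 0 \<le> c \<Longrightarrow> psd n (complex_of_real c \<cdot>\<^sub>m A)"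
  by (auto simp: psd_iff_qform qform_smult less_eq_complex_def)

lemma psd_one: "psd n (1\<^sub>m n)"
proof -
  have "unitary_mat n (1\<^sub>m n)" by (simp add: unitary_mat_def)
  from psd_unitary_diag_iff[OF this, of "\<lambda>_. 1"] unitary_diag_one[OF this] show ?thesis by simp
qed

lemma psd_imp_hermitian:
  assumes "psd n A"
  shows "hermitian_mat n A"
proof -
  note A = psd_carrier[OF assms]
  define H where "H = \<i> \<cdot>\<^sub>m (A - mat_adjoint A)"
  have "mat_adjoint H = H"
    using A by (intro eq_matI) (auto simp: H_def algebra_simps)
  hence "hermitian_mat n H"
    using A by (simp add: hermitian_mat_def H_def)
  then obtain U d where U: "unitary_mat n U" and H: "H = unitary_diag U d"
    by (rule spectral_theorem)
  have "complex_of_real (d i) = 0" if i: "i < n" for i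
  proof -
    let ?v = "col U i"
    have "qform A ?v = cnj (qform A ?v)"
      using assms U by (auto simp: psd_iff_qform less_eq_complex_def complex_eq_iff)
    hence "qform H ?v = 0"
      using A U by (simp add: H_def qform_smult qform_minus qform_adjoint)
    thus ?thesis using qform_unitary_diag[OF U i, of d] H by simp
  qed
  hence H0: "H $$ (i, j) = 0" if "i < n" "j < n" for i j
    using that by (simp add: H index_unitary_diag[OF U])
  have "mat_adjoint A = A"
  proof (rule eq_matI)
    fix i j assume "i < dim_row A" "j < dim_col A"
    thus "mat_adjoint A $$ (i, j) = A $$ (i, j)"
      using H0[of i j] A by (simp add: H_def)
  qed (use A in auto)
  thus ?thesis using A by (simp add: hermitian_mat_def)
qed

lemma hermitian_minus: "hermitian_mat n A \<Longrightarrow> hermitian_mat n B \<Longrightarrow> hermitian_mat n (A - B)"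
  by (simp add: hermitian_mat_def mat_adjoint_minus[of _ n n])

lemma psd_spectral:
  assumes "psd n A"
  obtains U d where "unitary_mat n U" "A = unitary_diag U d" "\<And>i. i < n \<Longrightarrow> 0 \<le> d i"
  using spectral_theorem[OF psd_imp_hermitian[OF assms]] psd_unitary_diag_iff assms by metis

lemma mtrace_psd_mult_nonneg:
  assumes A: "psd n A" and B: "psd n B"
  shows "0 \<le> mtrace (A * B)"
proof -
  obtain U d where U: "unitary_mat n U" and A: "A = unitary_diag U d"
    and d: "\<And>i. i < n \<Longrightarrow> 0 \<le> d i"
    using psd_spectral[OF A] by blast
  have "0 \<le> qform B (col U i)" if "i < n" for i
    using B U by (simp add: psd_iff_qform)
  thus ?thesis unfolding A mtrace_unitary_diag_mult[OF U psd_carrier[OF B]]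
    using d by (auto intro!: sum_nonneg mult_nonneg_nonneg simp: less_eq_complex_def)
qed

lemma hermitian_add_smult_one_psd:
  assumes "hermitian_mat n A"
  obtains m where "0 < m" "psd n (A + complex_of_real m \<cdot>\<^sub>m 1\<^sub>m n)"
proof -
  obtain U d where U: "unitary_mat n U" and A: "A = unitary_diag U d"
    using spectral_theorem[OF assms] .
  define m where "m = 1 + (\<Sum>i<n. \<bar>d i\<bar>)"
  have "0 \<le> d i + m" if "i < n" for i
    using member_le_sum[of i "{..<n}" "\<lambda>i. \<bar>d i\<bar>"] that by (simp add: m_def)
  hence "psd n (A + complex_of_real m \<cdot>\<^sub>m 1\<^sub>m n)"
    by (simp add: A unitary_diag_add_smult_one U psd_unitary_diag_iff)
  moreover have "0 < m" by (simp add: m_def add_pos_nonneg sum_nonneg)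
  ultimately show thesis using that by blast
qed

lemma traceless_hermitian_eq_density_diff:
  assumes n: "0 < n" and A: "hermitian_mat n A" and tr: "mtrace A = 0"
  obtains t \<rho> \<rho>' where "0 < t" "\<rho> \<in> density n" "\<rho>' \<in> density n"
    "A = complex_of_real t \<cdot>\<^sub>m (\<rho> - \<rho>')"
proof -
  obtain m where m: "0 < m" "psd n (A + complex_of_real m \<cdot>\<^sub>m 1\<^sub>m n)"
    using hermitian_add_smult_one_psd[OF A] .
  note A_carrier = hermitian_matD(1)[OF A]
  define t where "t = m * real n"
  define \<rho> where "\<rho> = complex_of_real (1 / t) \<cdot>\<^sub>m (A + complex_of_real m \<cdot>\<^sub>m 1\<^sub>m n)"
  define \<rho>' where "\<rho>' = complex_of_real (1 / real n) \<cdot>\<^sub>m 1\<^sub>m n"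
  have t: "0 < t" using m(1) n by (simp add: t_def)
  moreover have "psd n \<rho>" unfolding \<rho>_def using t m(2) by (intro psd_smult) auto
  hence "\<rho> \<in> density n"
    using t m(1) n A_carrier tr
    by (simp add: density_def \<rho>_def mtrace_smult mtrace_add mtrace_one t_def)
  moreover have "\<rho>' \<in> density n"
    using n psd_smult[OF psd_one, of "1 / real n"]
    by (simp add: density_def \<rho>'_def mtrace_smult mtrace_one)
  moreover have "A = complex_of_real t \<cdot>\<^sub>m (\<rho> - \<rho>')"
    using A_carrier m(1) n by (intro eq_matI) (auto simp: \<rho>_def \<rho>'_def t_def field_simps)
  ultimately show thesis by (rule that)
qed

end

section \<open>Functions of the spectrum and the trace norm\<close>

lemma sum_mset_eq_sum_count:
  fixes f :: "'a \<Rightarrow> 'b :: comm_semiring_1"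
  assumes "finite S" "set_mset M \<subseteq> S"
  shows "(\<Sum>x\<in>#M. f x) = (\<Sum>x\<in>S. of_nat (count M x) * f x)"
  using assms(2)
proof (induction M)
  case (add x M)
  have "(\<Sum>y\<in>S. of_nat (count (add_mset x M) y) * f y)
      = (\<Sum>y\<in>S. (if y = x then f y else 0) + of_nat (count M y) * f y)"
    by (intro sum.cong) (auto simp: algebra_simps)
  with add assms(1) show ?case by (simp add: sum.distrib)
qed simp

lemma trace_fun_eq_sum_proots:
  assumes "char_poly A \<noteq> 0"
  shows "trace_fun f A = (\<Sum>a\<in>#proots (char_poly A). f (Re a))"
  using assms by (simp add: trace_fun_def sum_mset_eq_sum_count[OF finite_set_mset subset_refl])

context matrix_algebra
begin

lemma trace_fun_unitary_diag:
  assumes U: "unitary_mat n U"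
  shows "trace_fun f (unitary_diag U d) = (\<Sum>i<n. f (d i))"
proof -
  let ?D = "mat_diag n (\<lambda>i. complex_of_real (d i))"
  let ?es = "map (\<lambda>i. complex_of_real (d i)) [0..<n]"
  have "similar_mat (unitary_diag U d) ?D"
    using unitary_matD[OF U]
    by (intro similar_matI[of _ _ U "mat_adjoint U" n]) (auto simp: unitary_diag_def)
  hence "char_poly (unitary_diag U d) = char_poly ?D" by (rule char_poly_similar)
  also have "\<dots> = (\<Prod>a\<leftarrow>diag_mat ?D. [:- a, 1:])"
    by (rule char_poly_upper_triangular[of _ n]) (auto simp: mat_diag_def)
  also have "diag_mat ?D = ?es" by (auto simp: diag_mat_def mat_diag_def)
  finally have char_poly: "char_poly (unitary_diag U d) = (\<Prod>p\<leftarrow>map (\<lambda>a. [:- a, 1:]) ?es. p)"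
    by simp
  have "proots (char_poly (unitary_diag U d)) = mset ?es"
    unfolding char_poly by (subst proots_prod_list) (auto simp: comp_def)
  moreover have "char_poly (unitary_diag U d) \<noteq> 0"
    unfolding char_poly by (auto simp: prod_list_zero_iff)
  ultimately show ?thesis
    by (simp add: trace_fun_eq_sum_proots image_mset.compositionality comp_def lessThan_atLeast0
        sum_unfold_sum_mset)
qed

lemma trace_norm_unitary_diag:
  assumes "unitary_mat n U"
  shows "trace_norm (unitary_diag U d) = (\<Sum>i<n. \<bar>d i\<bar>)"
  using hermitian_unitary_diag[OF assms, of d]
  by (simp add: trace_norm_def hermitian_mat_def unitary_diag_mult[OF assms]
      trace_fun_unitary_diag[OF assms])

lemma trace_norm_hermitian:
  assumes "hermitian_mat n A"
  shows "trace_norm A = trace_fun abs A"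
proof -
  obtain U d where "unitary_mat n U" "A = unitary_diag U d" using spectral_theorem[OF assms] .
  thus ?thesis by (simp add: trace_norm_unitary_diag trace_fun_unitary_diag)
qed

lemma trace_norm_smult:
  assumes "hermitian_mat n A"
  shows "trace_norm (complex_of_real c \<cdot>\<^sub>m A) = \<bar>c\<bar> * trace_norm A"
proof -
  obtain U d where "unitary_mat n U" "A = unitary_diag U d" using spectral_theorem[OF assms] .
  thus ?thesis
    by (simp add: unitary_diag_smult trace_norm_unitary_diag abs_mult sum_distrib_left)
qed

end

section \<open>The Hilbert-Schmidt inner product\<close>

definition hs_inner :: "complex mat \<Rightarrow> complex mat \<Rightarrow> complex" where
  "hs_inner A B = mtrace (mat_adjoint A * B)"

lemma hs_inner_eq_sum:
  assumes "A \<in> carrier_mat m n" "B \<in> carrier_mat m n"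
  shows "hs_inner A B = (\<Sum>p\<in>{..<m} \<times> {..<n}. cnj (A $$ p) * B $$ p)"
proof -
  have "hs_inner A B = (\<Sum>j<n. \<Sum>i<m. cnj (A $$ (i, j)) * B $$ (i, j))"
    using assms by (simp add: hs_inner_def mtrace_mult_eq_sum[of _ n m])
  also have "\<dots> = (\<Sum>i<m. \<Sum>j<n. cnj (A $$ (i, j)) * B $$ (i, j))"
    by (rule sum.swap)
  finally show ?thesis by (simp add: sum.cartesian_product case_prod_unfold)
qed

lemma hs_norm_eq_L2_set:
  assumes "A \<in> carrier_mat m n"
  shows "hs_norm A = L2_set (\<lambda>p. cmod (A $$ p)) ({..<m} \<times> {..<n})"
proof -
  have "Re (hs_inner A A) = (\<Sum>p\<in>{..<m} \<times> {..<n}. (cmod (A $$ p))\<^sup>2)"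
    by (simp add: hs_inner_eq_sum[OF assms assms] mult.commute flip: complex_norm_square)
  thus ?thesis by (simp add: hs_norm_def hs_inner_def L2_set_def)
qed

lemma hs_norm_nonneg [simp]: "0 \<le> hs_norm A"
  using hs_norm_eq_L2_set[of A "dim_row A" "dim_col A"] by simp

lemma hs_norm_eq_0_iff:
  assumes "A \<in> carrier_mat m n"
  shows "hs_norm A = 0 \<longleftrightarrow> A = 0\<^sub>m m n"
  using assms by (auto simp: hs_norm_eq_L2_set L2_set_eq_0_iff intro!: eq_matI)

lemma hs_inner_self: "hs_inner A A = complex_of_real ((hs_norm A)\<^sup>2)"
proof -
  have A: "A \<in> carrier_mat (dim_row A) (dim_col A)" by simp
  show ?thesis
    unfolding hs_inner_eq_sum[OF A A] hs_norm_eq_L2_set[OF A]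
    by (simp add: L2_set_def sum_nonneg mult.commute flip: complex_norm_square of_real_power)
qed

lemma hs_inner_cauchy_schwarz:
  assumes "A \<in> carrier_mat m n" "B \<in> carrier_mat m n"
  shows "cmod (hs_inner A B) \<le> hs_norm A * hs_norm B"
proof -
  let ?S = "{..<m} \<times> {..<n}"
  have "cmod (hs_inner A B) \<le> (\<Sum>p\<in>?S. \<bar>cmod (A $$ p)\<bar> * \<bar>cmod (B $$ p)\<bar>)"
    unfolding hs_inner_eq_sum[OF assms] by (rule order_trans[OF norm_sum]) (simp add: norm_mult)
  also have "\<dots> \<le> hs_norm A * hs_norm B"
    unfolding hs_norm_eq_L2_set[OF assms(1)] hs_norm_eq_L2_set[OF assms(2)]
    by (rule L2_set_mult_ineq)
  finally show ?thesis .
qed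

lemma hs_norm_triangle_ineq:
  assumes "A \<in> carrier_mat m n" "B \<in> carrier_mat m n"
  shows "hs_norm (A + B) \<le> hs_norm A + hs_norm B"
proof -
  let ?S = "{..<m} \<times> {..<n}"
  have "hs_norm (A + B) = L2_set (\<lambda>p. cmod (A $$ p + B $$ p)) ?S"
    using assms by (auto simp: hs_norm_eq_L2_set[of _ m n] intro!: L2_set_cong)
  also have "\<dots> \<le> L2_set (\<lambda>p. cmod (A $$ p) + cmod (B $$ p)) ?S"
    by (intro L2_set_mono norm_triangle_ineq norm_ge_zero)
  also have "\<dots> \<le> hs_norm A + hs_norm B"
    unfolding hs_norm_eq_L2_set[OF assms(1)] hs_norm_eq_L2_set[OF assms(2)]
    by (rule L2_set_triangle_ineq)
  finally show ?thesis .
qed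

lemma hs_norm_smult: "hs_norm (c \<cdot>\<^sub>m A) = cmod c * hs_norm A"
proof -
  have A: "A \<in> carrier_mat (dim_row A) (dim_col A)" by simp
  hence "hs_norm (c \<cdot>\<^sub>m A) = L2_set (\<lambda>p. cmod c * cmod (A $$ p)) ({..<dim_row A} \<times> {..<dim_col A})"
    by (subst hs_norm_eq_L2_set[OF smult_carrier_mat[OF A]])
      (auto simp: norm_mult intro!: L2_set_cong)
  thus ?thesis by (simp add: hs_norm_eq_L2_set[OF A] L2_set_right_distrib)
qed

lemma hs_norm_symmetric_operator_le:
  assumes X: "X \<in> carrier_mat m n"
    and L: "\<And>A. A \<in> carrier_mat m n \<Longrightarrow> L A \<in> carrier_mat m n"
    and sym: "\<And>A B. A \<in> carrier_mat m n \<Longrightarrow> B \<in> carrier_mat m n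
      \<Longrightarrow> hs_inner (L A) B = hs_inner A (L B)"
    and bound: "\<And>k. hs_norm ((L ^^ k) X) \<le> K * C ^ k" and C: "0 \<le> C"
  shows "hs_norm (L X) \<le> C * hs_norm X"
proof -
  have iterate: "(L ^^ k) X \<in> carrier_mat m n" for k
    by (induction k) (simp_all add: X L)
  have "(hs_norm (L Y))\<^sup>2 \<le> hs_norm Y * hs_norm (L (L Y))" if Y: "Y \<in> carrier_mat m n" for Y
  proof -
    have "hs_inner Y (L (L Y)) = complex_of_real ((hs_norm (L Y))\<^sup>2)"
      using sym[OF Y L[OF Y]] by (simp add: hs_inner_self)
    hence "(hs_norm (L Y))\<^sup>2 = cmod (hs_inner Y (L (L Y)))" by (simp add: norm_power)
    also have "\<dots> \<le> hs_norm Y * hs_norm (L (L Y))"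
      by (rule hs_inner_cauchy_schwarz[OF Y L[OF L[OF Y]]])
    finally show ?thesis .
  qed
  from this[OF iterate] have "hs_norm ((L ^^ 1) X) \<le> C * hs_norm ((L ^^ 0) X)"
    by (intro log_convex_geometric_bound[OF _ _ bound C]) simp_all
  thus ?thesis by simp
qed

context matrix_algebra
begin

lemma hs_norm_unitary_diag:
  assumes "unitary_mat n U"
  shows "hs_norm (unitary_diag U d) = L2_set d {..<n}"
proof -
  have "hs_inner (unitary_diag U d) (unitary_diag U d) = (\<Sum>i<n. (d i)\<^sup>2)"
    using hermitian_unitary_diag[OF assms, of d] unitary_diag_mult[OF assms]
      mtrace_unitary_diag[OF assms]
    by (simp add: hs_inner_def hermitian_mat_def power2_eq_square)
  thus ?thesis by (simp add: hs_norm_def hs_inner_def L2_set_def)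
qed

lemma hs_norm_le_trace_norm:
  assumes "hermitian_mat n A"
  shows "hs_norm A \<le> trace_norm A"
proof -
  obtain U d where "unitary_mat n U" "A = unitary_diag U d" using spectral_theorem[OF assms] .
  thus ?thesis by (simp add: hs_norm_unitary_diag trace_norm_unitary_diag L2_set_le_sum_abs)
qed

lemma trace_fun_xlnx_minus_half_square:
  assumes "hermitian_mat n A"
  shows "trace_fun (\<lambda>x. x * ln x - (x - c)\<^sup>2 / 2) A
    = - vn_entropy A - (hs_norm (A - complex_of_real c \<cdot>\<^sub>m 1\<^sub>m n))\<^sup>2 / 2"
proof -
  obtain U d where U: "unitary_mat n U" and A: "A = unitary_diag U d"
    using spectral_theorem[OF assms] .
  have "A - complex_of_real c \<cdot>\<^sub>m 1\<^sub>m n = A + complex_of_real (- c) \<cdot>\<^sub>m 1\<^sub>m n"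
    using hermitian_matD(1)[OF assms] by (intro eq_matI) auto
  hence "A - complex_of_real c \<cdot>\<^sub>m 1\<^sub>m n = unitary_diag U (\<lambda>i. d i - c)"
    using unitary_diag_add_smult_one[OF U, of d "- c"] by (simp add: A)
  hence "(hs_norm (A - complex_of_real c \<cdot>\<^sub>m 1\<^sub>m n))\<^sup>2 = (\<Sum>i<n. (d i - c)\<^sup>2)"
    by (simp add: hs_norm_unitary_diag[OF U] L2_set_def sum_nonneg)
  thus ?thesis
    by (simp add: A vn_entropy_def trace_fun_unitary_diag[OF U] sum_subtractf sum_divide_distrib)
qed

end

section \<open>Positive maps and duality\<close>

lemma linear_map_onD:
  assumes "linear_map_on n F"
  shows "A \<in> carrier_mat n n \<Longrightarrow> F A \<in> carrier_mat n n"
    "A \<in> carrier_mat n n \<Longrightarrow> B \<in> carrier_mat n n \<Longrightarrow> F (A + B) = F A + F B"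
    "A \<in> carrier_mat n n \<Longrightarrow> F (c \<cdot>\<^sub>m A) = c \<cdot>\<^sub>m F A"
  using assms by (auto simp: linear_map_on_def)

lemma linear_map_on_minus:
  assumes F: "linear_map_on n F" and A: "A \<in> carrier_mat n n" and B: "B \<in> carrier_mat n n"
  shows "F (A - B) = F A - F B"
proof -
  have minus_eq: "M - M' = M + (- 1) \<cdot>\<^sub>m M'"
    if "M \<in> carrier_mat n n" "M' \<in> carrier_mat n n" for M M' :: "complex mat"
    using that by (intro eq_matI) auto
  show ?thesis using linear_map_onD[OF F] A B by (simp add: minus_eq)
qed

lemma linear_map_on_funpow:
  assumes F: "linear_map_on n F"
  shows "linear_map_on n (F ^^ k)"
proof (induction k)
  case (Suc k)
  with F show ?case by (simp add: linear_map_on_def)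
qed (simp add: linear_map_on_def)

context matrix_algebra
begin

definition positive_map :: "(complex mat \<Rightarrow> complex mat) \<Rightarrow> bool" where
  "positive_map F \<longleftrightarrow> linear_map_on n F \<and> (\<forall>X. psd n X \<longrightarrow> psd n (F X))"

lemma positive_mapD:
  assumes "positive_map F"
  shows "linear_map_on n F" "psd n X \<Longrightarrow> psd n (F X)"
  using assms by (auto simp: positive_map_def)

lemma completely_positive_imp_positive_map:
  assumes F: "linear_map_on n F" and cp: "completely_positive n F"
  shows "positive_map F"
proof -
  have "psd n (F X)" if X: "psd n X" for X
  proof -
    note X_carrier = psd_carrier[OF X]
    have "mblock n X 0 0 = X" using X_carrier by (intro eq_matI) (auto simp: mblock_def)
    hence "ampliation 1 n F X = F X"
      using linear_map_onD(1)[OF F X_carrier] by (intro eq_matI) (auto simp: ampliation_def)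
    thus ?thesis using cp X unfolding completely_positive_def by (metis nat_mult_1)
  qed
  with F show ?thesis by (simp add: positive_map_def)
qed

lemma positive_map_hermitian:
  assumes F: "positive_map F" and A: "hermitian_mat n A"
  shows "hermitian_mat n (F A)"
proof -
  note lin = positive_mapD(1)[OF F] and pos = positive_mapD(2)[OF F]
  note A_carrier = hermitian_matD(1)[OF A] and one = one_carrier_mat[of n]
  obtain m where m: "psd n (A + complex_of_real m \<cdot>\<^sub>m 1\<^sub>m n)"
    using hermitian_add_smult_one_psd[OF A] by blast
  define P where "P = F (A + complex_of_real m \<cdot>\<^sub>m 1\<^sub>m n)"
  define Q where "Q = complex_of_real m \<cdot>\<^sub>m F (1\<^sub>m n)"
  have "P = F A + Q"
    using linear_map_onD(2,3)[OF lin] A_carrier by (simp add: P_def Q_def)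
  hence "F A = P - Q"
    using linear_map_onD(1)[OF lin A_carrier] linear_map_onD(1)[OF lin one]
    by (intro eq_matI) (auto simp: Q_def)
  moreover have "hermitian_mat n P" "hermitian_mat n Q"
    using psd_imp_hermitian[OF pos[OF m]] psd_imp_hermitian[OF pos[OF psd_one]]
    by (simp_all add: P_def Q_def hermitian_mat_def mat_adjoint_smult)
  ultimately show ?thesis by (simp add: hermitian_minus)
qed

lemma cartesian_decomposition:
  assumes X: "X \<in> \<M>"
  obtains A B where "hermitian_mat n A" "hermitian_mat n B"
    "X = A + \<i> \<cdot>\<^sub>m B" "mat_adjoint X = A + (- \<i>) \<cdot>\<^sub>m B"
proof
  let ?A = "(1 / 2) \<cdot>\<^sub>m (X + mat_adjoint X)" and ?B = "(- \<i> / 2) \<cdot>\<^sub>m (X - mat_adjoint X)"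
  have "mat_adjoint ?A = ?A" "mat_adjoint ?B = ?B"
    using X by (auto simp: algebra_simps intro!: eq_matI)
  thus "hermitian_mat n ?A" "hermitian_mat n ?B"
    using X by (simp_all add: hermitian_mat_def)
  show "X = ?A + \<i> \<cdot>\<^sub>m ?B" "mat_adjoint X = ?A + (- \<i>) \<cdot>\<^sub>m ?B"
    using X by (auto simp: field_simps intro!: eq_matI)
qed

lemma Im_mtrace_hermitian:
  assumes "hermitian_mat n A"
  shows "Im (mtrace A) = 0"
  using spectral_theorem[OF assms] mtrace_unitary_diag by (metis Im_complex_of_real)

lemma traceless_cartesian_decomposition:
  assumes X: "X \<in> \<M>" and tr: "mtrace X = 0"
  obtains A B where "hermitian_mat n A" "mtrace A = 0" "hermitian_mat n B" "mtrace B = 0"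
    "X = A + \<i> \<cdot>\<^sub>m B"
proof -
  obtain A B where AB: "hermitian_mat n A" "hermitian_mat n B" "X = A + \<i> \<cdot>\<^sub>m B"
    using cartesian_decomposition[OF X] by metis
  have "mtrace A + \<i> * mtrace B = 0"
    using tr AB by (simp add: mtrace_add mtrace_smult hermitian_matD(1))
  hence "mtrace A = 0" "mtrace B = 0"
    using Im_mtrace_hermitian[OF AB(1)] Im_mtrace_hermitian[OF AB(2)] by (auto simp: complex_eq_iff)
  with AB show thesis using that by blast
qed

lemma positive_map_adjoint:
  assumes F: "positive_map F" and X: "X \<in> \<M>"
  shows "F (mat_adjoint X) = mat_adjoint (F X)"
proof -
  obtain A B where A: "hermitian_mat n A" and B: "hermitian_mat n B"
    and X_eq: "X = A + \<i> \<cdot>\<^sub>m B" "mat_adjoint X = A + (- \<i>) \<cdot>\<^sub>m B"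
    using cartesian_decomposition[OF X] .
  have F_eq: "F (A + c \<cdot>\<^sub>m B) = F A + c \<cdot>\<^sub>m F B" for c
    using A B linear_map_onD[OF positive_mapD(1)[OF F]] by (simp add: hermitian_matD(1))
  have "hermitian_mat n (F A)" "hermitian_mat n (F B)"
    using positive_map_hermitian[OF F] A B by auto
  hence "mat_adjoint (F X) = F A + (- \<i>) \<cdot>\<^sub>m F B"
    by (simp add: X_eq(1) F_eq hermitian_mat_def mat_adjoint_add[of _ n n] mat_adjoint_smult)
  thus ?thesis by (simp add: X_eq(2) F_eq)
qed

lemma is_dual_sym:
  assumes dual: "is_dual n T T'" and T: "\<And>A. A \<in> \<M> \<Longrightarrow> T A \<in> \<M>"
  shows "is_dual n T' T"
  unfolding is_dual_def
proof (intro conjI ballI T)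
  fix A B assume A: "A \<in> \<M>" and B: "B \<in> \<M>"
  hence T'B: "T' B \<in> \<M>" using dual by (simp add: is_dual_def)
  have "mtrace (T A * B) = mtrace (B * T A)" by (rule mtrace_mult_comm[OF T[OF A] B])
  also have "\<dots> = mtrace (T' B * A)" using dual A B by (simp add: is_dual_def)
  also have "\<dots> = mtrace (A * T' B)" by (rule mtrace_mult_comm[OF T'B A])
  finally show "mtrace (T A * B) = mtrace (A * T' B)" .
qed

lemma is_dual_linear:
  assumes dual: "is_dual n T T'" and T: "\<And>A. A \<in> \<M> \<Longrightarrow> T A \<in> \<M>"
  shows "linear_map_on n T'"
proof -
  have T': "T' A \<in> \<M>" if "A \<in> \<M>" for A using dual that by (simp add: is_dual_def)
  have mtrace_T': "mtrace (T' A * B) = mtrace (A * T B)" if "A \<in> \<M>" "B \<in> \<M>" for A B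
    using dual that by (simp add: is_dual_def)
  have "T' (A + B) = T' A + T' B" if "A \<in> \<M>" "B \<in> \<M>" for A B
    using that T T'
    by (intro mat_eq_if_mtrace_mult_eq)
      (simp_all add: mtrace_T' add_mult_distrib_mat[of _ n n _ _ n] mtrace_add)
  moreover have "T' (c \<cdot>\<^sub>m A) = c \<cdot>\<^sub>m T' A" if "A \<in> \<M>" for c A
    using that T T'
    by (intro mat_eq_if_mtrace_mult_eq)
      (simp_all add: mtrace_T' mult_smult_assoc_mat[of _ n n _ n] mtrace_smult)
  ultimately show ?thesis using T' by (simp add: linear_map_on_def)
qed

lemma is_dual_positive:
  assumes dual: "is_dual n T T'" and T: "positive_map T"
  shows "positive_map T'"
  unfolding positive_map_def
proof (intro conjI allI impI)
  show "linear_map_on n T'"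
    by (rule is_dual_linear[OF dual linear_map_onD(1)[OF positive_mapD(1)[OF T]]])
  fix X assume X: "psd n X"
  have T'X: "T' X \<in> \<M>" using dual psd_carrier[OF X] by (simp add: is_dual_def)
  have "0 \<le> qform (T' X) v" if v: "v \<in> carrier_vec n" for v
  proof -
    have "qform (T' X) v = mtrace (X * T (outer_prod v))"
      using dual psd_carrier[OF X] v T'X by (simp add: is_dual_def flip: mtrace_mult_outer_prod)
    also have "0 \<le> \<dots>"
      by (rule mtrace_psd_mult_nonneg[OF X positive_mapD(2)[OF T psd_outer_prod[OF v]]])
    finally show ?thesis .
  qed
  with T'X show "psd n (T' X)" by (simp add: psd_iff_qform)
qed

lemma is_dual_trace_preserving:
  assumes "is_dual n T T'" "T (1\<^sub>m n) = 1\<^sub>m n" "A \<in> \<M>"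
  shows "mtrace (T' A) = mtrace A"
  using assms unfolding is_dual_def by (metis one_carrier_mat right_mult_one_mat)

lemma is_dual_hs_inner:
  assumes dual: "is_dual n T T'" and T': "positive_map T'" and A: "A \<in> \<M>" and B: "B \<in> \<M>"
  shows "hs_inner (T' A) B = hs_inner A (T B)"
  unfolding hs_inner_def positive_map_adjoint[OF T' A, symmetric]
  using dual A B by (simp add: is_dual_def)

end

section \<open>Bistochastic maps\<close>

locale bistochastic_map = matrix_algebra n for n :: nat +
  fixes T Th :: "complex mat \<Rightarrow> complex mat"
  assumes T_positive: "positive_map T" and dual: "is_dual n T Th"
    and T_one: "T (1\<^sub>m n) = 1\<^sub>m n" and Th_one: "Th (1\<^sub>m n) = 1\<^sub>m n"
begin

lemma T_linear: "linear_map_on n T"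
  by (rule positive_mapD(1)[OF T_positive])

lemma T_carrier [simp]: "A \<in> \<M> \<Longrightarrow> T A \<in> \<M>"
  by (rule linear_map_onD(1)[OF T_linear])

lemma Th_positive: "positive_map Th"
  by (rule is_dual_positive[OF dual T_positive])

lemma Th_linear: "linear_map_on n Th"
  by (rule positive_mapD(1)[OF Th_positive])

lemma Th_carrier [simp]: "A \<in> \<M> \<Longrightarrow> Th A \<in> \<M>"
  by (rule linear_map_onD(1)[OF Th_linear])

lemma dual_sym: "is_dual n Th T"
  by (rule is_dual_sym[OF dual T_carrier])

lemma bistochastic_map_dual: "bistochastic_map n Th T"
  by unfold_locales (rule Th_positive dual_sym Th_one T_one)+

lemma mtrace_Th [simp]: "A \<in> \<M> \<Longrightarrow> mtrace (Th A) = mtrace A"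
  by (rule is_dual_trace_preserving[OF dual T_one])

lemma mtrace_T [simp]: "A \<in> \<M> \<Longrightarrow> mtrace (T A) = mtrace A"
  by (rule is_dual_trace_preserving[OF dual_sym Th_one])

definition transition_matrix :: "complex mat \<Rightarrow> complex mat \<Rightarrow> nat \<Rightarrow> nat \<Rightarrow> real" where
  "transition_matrix U V j i = Re (qform (T (outer_prod (col V j))) (col U i))"

lemma qform_T_outer_prod_nonneg:
  assumes "unitary_mat n U" "unitary_mat n V"
  shows "0 \<le> qform (T (outer_prod (col V j))) (col U i)"
  using positive_mapD(2)[OF T_positive psd_outer_prod] assms by (simp add: psd_iff_qform)

lemma transition_matrix_nonneg:
  assumes "unitary_mat n U" "unitary_mat n V"
  shows "0 \<le> transition_matrix U V j i"
  using qform_T_outer_prod_nonneg[OF assms, of j i]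
  by (simp add: transition_matrix_def less_eq_complex_def)

lemma of_real_transition_matrix:
  assumes "unitary_mat n U" "unitary_mat n V"
  shows "complex_of_real (transition_matrix U V j i) = qform (T (outer_prod (col V j))) (col U i)"
  using qform_T_outer_prod_nonneg[OF assms, of j i]
  by (simp add: transition_matrix_def less_eq_complex_def complex_eq_iff)

lemma qform_Th:
  assumes "A \<in> \<M>" "v \<in> carrier_vec n"
  shows "qform (Th A) v = mtrace (A * T (outer_prod v))"
  using dual assms by (simp add: is_dual_def flip: mtrace_mult_outer_prod)

lemma doubly_stochastic_transition_matrix:
  assumes U: "unitary_mat n U" and V: "unitary_mat n V"
  shows "doubly_stochastic {..<n} (transition_matrix U V)"
  unfolding doubly_stochastic_def
proof (intro conjI ballI transition_matrix_nonneg[OF U V])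
  fix j assume j: "j \<in> {..<n}"
  have "complex_of_real (\<Sum>i<n. transition_matrix U V j i) = mtrace (T (outer_prod (col V j)))"
    using V by (simp add: mtrace_eq_sum_qform[OF U] of_real_transition_matrix[OF U V])
  also have "\<dots> = 1" using V j by (simp add: mtrace_outer_prod_col)
  finally show "(\<Sum>i<n. transition_matrix U V j i) = 1" by (simp only: of_real_eq_1_iff)
next
  fix i assume i: "i \<in> {..<n}"
  have "complex_of_real (transition_matrix U V j i) = qform (Th (outer_prod (col U i))) (col V j)"
    for j
    using U V mtrace_mult_comm[of "T (outer_prod (col V j))" n n "outer_prod (col U i)"]
    by (simp add: qform_Th mtrace_mult_outer_prod of_real_transition_matrix)
  hence "complex_of_real (\<Sum>j<n. transition_matrix U V j i) = mtrace (Th (outer_prod (col U i)))"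
    using U by (simp add: mtrace_eq_sum_qform[OF V])
  also have "\<dots> = 1" using U i by (simp add: mtrace_outer_prod_col)
  finally show "(\<Sum>j<n. transition_matrix U V j i) = 1" by (simp only: of_real_eq_1_iff)
qed

lemma eigenvalues_Th_eq_sum:
  assumes U: "unitary_mat n U" and V: "unitary_mat n V"
    and eq: "Th (unitary_diag U p) = unitary_diag V q" and j: "j < n"
  shows "q j = (\<Sum>i<n. transition_matrix U V j i * p i)"
proof -
  have "complex_of_real (q j) = mtrace (unitary_diag U p * T (outer_prod (col V j)))"
    using U V qform_unitary_diag[OF V j, of q] by (simp flip: eq qform_Th)
  also have "\<dots> = complex_of_real (\<Sum>i<n. transition_matrix U V j i * p i)"
    using U V by (simp add: mtrace_unitary_diag_mult of_real_transition_matrix mult.commute)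
  finally show ?thesis by (simp only: of_real_eq_iff)
qed

theorem trace_fun_convex_le:
  assumes f: "convex_on S f" and U: "unitary_mat n U" and p: "\<And>i. i < n \<Longrightarrow> p i \<in> S"
  shows "trace_fun f (Th (unitary_diag U p)) \<le> trace_fun f (unitary_diag U p)"
proof -
  obtain V q where V: "unitary_mat n V" and q: "Th (unitary_diag U p) = unitary_diag V q"
    using spectral_theorem[OF positive_map_hermitian[OF Th_positive hermitian_unitary_diag[OF U]]] .
  have "(\<Sum>j<n. f (q j)) \<le> (\<Sum>i<n. f (p i))"
    using doubly_stochastic_transition_matrix[OF U V] p eigenvalues_Th_eq_sum[OF U V q]
    by (intro sum_convex_doubly_stochastic_le[OF f]) auto
  thus ?thesis by (simp add: q trace_fun_unitary_diag U V)
qed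

lemma trace_norm_Th_le:
  assumes A: "hermitian_mat n A"
  shows "trace_norm (Th A) \<le> trace_norm A"
proof -
  obtain U d where U: "unitary_mat n U" and A_eq: "A = unitary_diag U d"
    using spectral_theorem[OF A] .
  have "convex_on UNIV (abs :: real \<Rightarrow> real)"
    using convex_on_dist[of UNIV "0 :: real"] by (simp add: dist_real_def)
  from trace_fun_convex_le[OF this U, of d] show ?thesis
    using A positive_map_hermitian[OF Th_positive A] by (simp add: A_eq trace_norm_hermitian)
qed

definition \<Lambda> :: "complex mat \<Rightarrow> complex mat" where
  "\<Lambda> A = T (Th A)"

lemma \<Lambda>_linear: "linear_map_on n \<Lambda>"
  using T_linear Th_linear by (simp add: \<Lambda>_def linear_map_on_def)

lemma \<Lambda>_carrier [simp]: "A \<in> \<M> \<Longrightarrow> \<Lambda> A \<in> \<M>"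
  by (simp add: \<Lambda>_def)

lemma mtrace_\<Lambda> [simp]: "A \<in> \<M> \<Longrightarrow> mtrace (\<Lambda> A) = mtrace A"
  by (simp add: \<Lambda>_def)

lemma \<Lambda>_hermitian: "hermitian_mat n A \<Longrightarrow> hermitian_mat n (\<Lambda> A)"
  by (simp add: \<Lambda>_def positive_map_hermitian T_positive Th_positive)

lemma hs_inner_\<Lambda>_left:
  assumes "A \<in> \<M>" "B \<in> \<M>"
  shows "hs_inner (\<Lambda> A) B = hs_inner (Th A) (Th B)"
  using assms is_dual_hs_inner[OF dual_sym T_positive] by (simp add: \<Lambda>_def)

lemma hs_inner_\<Lambda>_right:
  assumes "A \<in> \<M>" "B \<in> \<M>"
  shows "hs_inner A (\<Lambda> B) = hs_inner (Th A) (Th B)"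
  using assms is_dual_hs_inner[OF dual Th_positive] by (simp add: \<Lambda>_def)

theorem vn_entropy_gain:
  assumes \<sigma>: "\<sigma> \<in> density n"
  shows "((hs_norm (\<sigma> - complex_of_real c \<cdot>\<^sub>m 1\<^sub>m n))\<^sup>2
      - (hs_norm (Th \<sigma> - complex_of_real c \<cdot>\<^sub>m 1\<^sub>m n))\<^sup>2) / 2
    \<le> vn_entropy (Th \<sigma>) - vn_entropy \<sigma>"
proof -
  have psd: "psd n \<sigma>" and tr: "mtrace \<sigma> = 1" using \<sigma> by (auto simp: density_def)
  note herm = psd_imp_hermitian[OF psd]
  obtain U p where U: "unitary_mat n U" and \<sigma>_eq: "\<sigma> = unitary_diag U p"
    and p0: "\<And>i. i < n \<Longrightarrow> 0 \<le> p i"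
    using psd_spectral[OF psd] by blast
  have "complex_of_real (\<Sum>i<n. p i) = 1"
    using mtrace_unitary_diag[OF U, of p] tr by (simp add: \<sigma>_eq)
  hence "(\<Sum>i<n. p i) = 1" by (simp only: of_real_eq_1_iff)
  hence p: "p i \<in> {0..1}" if "i < n" for i
    using member_le_sum[of i "{..<n}" p] p0 that by simp
  show ?thesis
    using trace_fun_convex_le[where p = p, OF convex_on_xlnx_minus_half_square[of c] U p]
      trace_fun_xlnx_minus_half_square[OF herm, of c]
      trace_fun_xlnx_minus_half_square[OF positive_map_hermitian[OF Th_positive herm], of c]
    by (simp add: \<sigma>_eq diff_divide_distrib)
qed

end

section \<open>Strictly contractive bistochastic maps\<close>

locale strictly_contractive_bistochastic_map = bistochastic_map +
  fixes C :: real
  assumes strictly_contractive: "strictly_contractive n Th C" and n_pos: "0 < n"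
begin

lemma C_nonneg: "0 \<le> C" and C_less_1: "C < 1"
  using strictly_contractive by (auto simp: strictly_contractive_def)

lemma trace_norm_Th_traceless_le:
  assumes A: "hermitian_mat n A" and tr: "mtrace A = 0"
  shows "trace_norm (Th A) \<le> C * trace_norm A"
proof -
  obtain t \<rho> \<rho>' where t: "0 < t" and \<rho>: "\<rho> \<in> density n" "\<rho>' \<in> density n"
    and A_eq: "A = complex_of_real t \<cdot>\<^sub>m (\<rho> - \<rho>')"
    using traceless_hermitian_eq_density_diff[OF n_pos A tr] .
  have carriers: "\<rho> \<in> \<M>" "\<rho>' \<in> \<M>" using \<rho> by (auto simp: density_def psd_def)
  have Th_A: "Th A = complex_of_real t \<cdot>\<^sub>m (Th \<rho> - Th \<rho>')"
    using carriers
    by (simp add: A_eq linear_map_onD(3)[OF Th_linear] linear_map_on_minus[OF Th_linear])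
  have "hermitian_mat n (\<rho> - \<rho>')"
    using psd_imp_hermitian \<rho> hermitian_minus by (simp add: density_def)
  moreover from positive_map_hermitian[OF Th_positive this] have "hermitian_mat n (Th \<rho> - Th \<rho>')"
    by (simp add: linear_map_on_minus[OF Th_linear carriers])
  moreover have "trace_norm (Th \<rho> - Th \<rho>') \<le> C * trace_norm (\<rho> - \<rho>')"
    using strictly_contractive \<rho> by (simp add: strictly_contractive_def)
  ultimately show ?thesis unfolding Th_A using t by (simp add: A_eq trace_norm_smult)
qed

lemma iterate_\<Lambda>_traceless_hermitian:
  assumes A: "hermitian_mat n A" and tr: "mtrace A = 0"
  shows "hermitian_mat n ((\<Lambda> ^^ k) A)" and "mtrace ((\<Lambda> ^^ k) A) = 0"
proof (induction k)
  case (Suc k)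
  case 1
  show ?case using Suc by (simp add: \<Lambda>_hermitian)
  case 2
  show ?case using Suc by (simp add: hermitian_matD(1))
qed (simp_all add: A tr)

lemma trace_norm_iterate_\<Lambda>_le:
  assumes A: "hermitian_mat n A" and tr: "mtrace A = 0"
  shows "trace_norm ((\<Lambda> ^^ k) A) \<le> trace_norm A * C ^ k"
proof (induction k)
  case (Suc k)
  let ?Y = "(\<Lambda> ^^ k) A"
  note Y = iterate_\<Lambda>_traceless_hermitian[OF A tr, of k]
  interpret dual: bistochastic_map n Th T by (rule bistochastic_map_dual)
  have "trace_norm (T (Th ?Y)) \<le> trace_norm (Th ?Y)"
    by (rule dual.trace_norm_Th_le[OF positive_map_hermitian[OF Th_positive Y(1)]])
  also have "\<dots> \<le> C * trace_norm ?Y" by (rule trace_norm_Th_traceless_le[OF Y])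
  also have "\<dots> \<le> C * (trace_norm A * C ^ k)" by (rule mult_left_mono[OF Suc C_nonneg])
  finally show ?case by (simp add: \<Lambda>_def[of ?Y] mult_ac)
qed simp

lemma hs_norm_iterate_\<Lambda>_le:
  assumes X: "X \<in> \<M>" and tr: "mtrace X = 0"
  obtains K where "\<And>k. hs_norm ((\<Lambda> ^^ k) X) \<le> K * C ^ k"
proof -
  obtain A B where A: "hermitian_mat n A" "mtrace A = 0" and B: "hermitian_mat n B" "mtrace B = 0"
    and X_eq: "X = A + \<i> \<cdot>\<^sub>m B"
    using traceless_cartesian_decomposition[OF X tr] .
  have "hs_norm ((\<Lambda> ^^ k) X) \<le> (trace_norm A + trace_norm B) * C ^ k" for k
  proof -
    note iterate = linear_map_onD[OF linear_map_on_funpow[OF \<Lambda>_linear]]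
    have hermitian_bound: "hs_norm ((\<Lambda> ^^ k) M) \<le> trace_norm M * C ^ k"
      if "hermitian_mat n M" "mtrace M = 0" for M
      using hs_norm_le_trace_norm[OF iterate_\<Lambda>_traceless_hermitian(1)[OF that]]
        trace_norm_iterate_\<Lambda>_le[OF that] by (rule order_trans)
    have carriers: "A \<in> \<M>" "B \<in> \<M>" using A B by (simp_all add: hermitian_matD(1))
    have "hs_norm ((\<Lambda> ^^ k) X) = hs_norm ((\<Lambda> ^^ k) A + \<i> \<cdot>\<^sub>m (\<Lambda> ^^ k) B)"
      using carriers by (simp add: X_eq iterate)
    also have "\<dots> \<le> hs_norm ((\<Lambda> ^^ k) A) + hs_norm (\<i> \<cdot>\<^sub>m (\<Lambda> ^^ k) B)"
      using carriers by (intro hs_norm_triangle_ineq[of _ n n]) (auto simp: iterate)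
    also have "\<dots> \<le> trace_norm A * C ^ k + trace_norm B * C ^ k"
      using hermitian_bound[OF A] hermitian_bound[OF B] by (simp add: hs_norm_smult)
    finally show ?thesis by (simp add: algebra_simps)
  qed
  thus thesis by (rule that)
qed

lemma hs_norm_\<Lambda>_traceless_le:
  assumes X: "X \<in> \<M>" and tr: "mtrace X = 0"
  shows "hs_norm (\<Lambda> X) \<le> C * hs_norm X"
proof -
  obtain K where K: "\<And>k. hs_norm ((\<Lambda> ^^ k) X) \<le> K * C ^ k"
    using hs_norm_iterate_\<Lambda>_le[OF X tr] by blast
  show ?thesis
    by (rule hs_norm_symmetric_operator_le[OF X _ _ K C_nonneg])
      (simp_all add: hs_inner_\<Lambda>_left hs_inner_\<Lambda>_right)
qed

theorem hs_norm_Th_traceless_le: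
  assumes X: "X \<in> \<M>" and tr: "mtrace X = 0"
  shows "(hs_norm (Th X))\<^sup>2 \<le> C * (hs_norm X)\<^sup>2"
proof -
  have "hs_inner X (\<Lambda> X) = complex_of_real ((hs_norm (Th X))\<^sup>2)"
    using X by (simp add: hs_inner_\<Lambda>_right hs_inner_self)
  hence "(hs_norm (Th X))\<^sup>2 = cmod (hs_inner X (\<Lambda> X))" by (simp add: norm_power)
  also have "\<dots> \<le> hs_norm X * hs_norm (\<Lambda> X)"
    using X by (intro hs_inner_cauchy_schwarz[of _ n n]) simp_all
  also have "\<dots> \<le> hs_norm X * (C * hs_norm X)"
    by (intro mult_left_mono hs_norm_\<Lambda>_traceless_le X tr) simp
  finally show ?thesis by (simp add: power2_eq_square mult_ac)
qed

lemma mtrace_minus_mean: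
  assumes "X \<in> \<M>"
  shows "mtrace (X - (mtrace X / of_nat n) \<cdot>\<^sub>m 1\<^sub>m n) = 0"
  using assms n_pos by (simp add: mtrace_minus mtrace_smult mtrace_one)

lemma Th_smult_one: "Th (c \<cdot>\<^sub>m 1\<^sub>m n) = c \<cdot>\<^sub>m 1\<^sub>m n"
  by (simp add: linear_map_onD(3)[OF Th_linear] Th_one)

lemma hs_norm_Th_minus_mean_le:
  assumes X: "X \<in> \<M>"
  defines "\<chi> \<equiv> mtrace X / of_nat n"
  shows "(hs_norm (Th X - \<chi> \<cdot>\<^sub>m 1\<^sub>m n))\<^sup>2 \<le> C * (hs_norm (X - \<chi> \<cdot>\<^sub>m 1\<^sub>m n))\<^sup>2"
  using hs_norm_Th_traceless_le[of "X - \<chi> \<cdot>\<^sub>m 1\<^sub>m n"] mtrace_minus_mean[OF X] X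
  by (simp add: \<chi>_def linear_map_on_minus[OF Th_linear] Th_smult_one)

theorem fixed_point_iff:
  assumes X: "X \<in> \<M>"
  shows "Th X = X \<longleftrightarrow> (\<exists>\<chi>. X = \<chi> \<cdot>\<^sub>m 1\<^sub>m n)"
proof
  assume fixed: "Th X = X"
  define Y where "Y = X - (mtrace X / of_nat n) \<cdot>\<^sub>m 1\<^sub>m n"
  have "(1 - C) * (hs_norm Y)\<^sup>2 \<le> 0"
    using hs_norm_Th_minus_mean_le[OF X] fixed by (simp add: Y_def algebra_simps)
  hence "hs_norm Y = 0" using C_less_1 by (simp add: mult_le_0_iff)
  hence "X - (mtrace X / of_nat n) \<cdot>\<^sub>m 1\<^sub>m n = 0\<^sub>m n n"
    using X by (simp add: Y_def hs_norm_eq_0_iff[of _ n n])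
  hence "X = (mtrace X / of_nat n) \<cdot>\<^sub>m 1\<^sub>m n"
    using X by (rule minus_mat_eq_zero_imp_eq[rotated 2]) simp_all
  thus "\<exists>\<chi>. X = \<chi> \<cdot>\<^sub>m 1\<^sub>m n" ..
qed (auto simp: Th_smult_one)

theorem op_eigenvalue_\<Lambda>_in_interval:
  assumes ev: "op_eigenvalue n \<Lambda> \<mu>" and \<mu>: "\<mu> \<noteq> 1"
  shows "\<mu> \<in> complex_of_real ` {0..C}"
proof -
  obtain X where X: "X \<in> \<M>" "X \<noteq> 0\<^sub>m n n" and \<Lambda>X: "\<Lambda> X = \<mu> \<cdot>\<^sub>m X"
    using ev by (auto simp: op_eigenvalue_def)
  have "mtrace X = \<mu> * mtrace X"
    using mtrace_\<Lambda>[OF X(1)] by (simp add: \<Lambda>X mtrace_smult[OF X(1)])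
  hence tr: "mtrace X = 0" using \<mu> by simp
  define r where "r = (hs_norm (Th X))\<^sup>2 / (hs_norm X)\<^sup>2"
  have X_pos: "0 < (hs_norm X)\<^sup>2" using X by (simp add: hs_norm_eq_0_iff[of _ n n])
  have "complex_of_real ((hs_norm (Th X))\<^sup>2) = hs_inner X (\<mu> \<cdot>\<^sub>m X)"
    using hs_inner_\<Lambda>_right[OF X(1) X(1)] by (simp add: \<Lambda>X hs_inner_self)
  also have "\<dots> = \<mu> * complex_of_real ((hs_norm X)\<^sup>2)"
    using X(1) mult_smult_distrib[of "mat_adjoint X" n n X n \<mu>] hs_inner_self[of X]
    by (simp add: hs_inner_def mtrace_smult)
  finally have "\<mu> = complex_of_real r" using X_pos by (simp add: r_def field_simps)
  moreover have "r \<in> {0..C}"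
    using hs_norm_Th_traceless_le[OF X(1) tr] X_pos by (simp add: r_def field_simps)
  ultimately show ?thesis by blast
qed

theorem vn_entropy_gain_contractive:
  assumes \<sigma>: "\<sigma> \<in> density n"
  shows "(1 - C) / 2 * (hs_norm (\<sigma> - (1 / of_nat n) \<cdot>\<^sub>m 1\<^sub>m n))\<^sup>2
    \<le> vn_entropy (Th \<sigma>) - vn_entropy \<sigma>"
proof -
  let ?dist = "\<lambda>\<rho>. (hs_norm (\<rho> - (1 / of_nat n) \<cdot>\<^sub>m 1\<^sub>m n))\<^sup>2"
  have "\<sigma> \<in> \<M>" "mtrace \<sigma> = 1" using \<sigma> by (auto simp: density_def psd_def)
  with hs_norm_Th_minus_mean_le[of \<sigma>] have "?dist (Th \<sigma>) \<le> C * ?dist \<sigma>" by simp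
  hence "(1 - C) / 2 * ?dist \<sigma> \<le> (?dist \<sigma> - ?dist (Th \<sigma>)) / 2" by (simp add: field_simps)
  also have "\<dots> \<le> vn_entropy (Th \<sigma>) - vn_entropy \<sigma>"
    using vn_entropy_gain[OF \<sigma>, of "1 / real n"] by simp
  finally show ?thesis .
qed

end

theorem theorem2:
  fixes N :: nat and T Th :: "complex mat \<Rightarrow> complex mat" and C :: real
  assumes "N \<ge> 2"
    and "channel N T"
    and "is_dual N T Th"
    and "Th (1\<^sub>m N) = 1\<^sub>m N"
    and "strictly_contractive N Th C"
  shows "(\<forall>X \<in> carrier_mat N N. Th X = X \<longleftrightarrow> (\<exists>\<chi>::complex. X = \<chi> \<cdot>\<^sub>m 1\<^sub>m N))
       \<and> (\<exists>\<gamma>::real. \<gamma> \<ge> 1 - C \<and>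
            (\<forall>\<mu>. op_eigenvalue N (T \<circ> Th) \<mu> \<longrightarrow>
                 \<mu> \<in> complex_of_real ` {0 .. 1 - \<gamma>} \<or> \<mu> = 1))
       \<and> (\<forall>\<sigma> \<in> density N.
            vn_entropy (Th \<sigma>) - vn_entropy \<sigma> \<ge>
              (1 - C) / 2 * (hs_norm (\<sigma> - (1 / of_nat N) \<cdot>\<^sub>m 1\<^sub>m N))\<^sup>2)"
proof -
  interpret strictly_contractive_bistochastic_map N T Th C
  proof
    show "matrix_algebra.positive_map N T"
      using assms(2) matrix_algebra.completely_positive_imp_positive_map
      by (auto simp: channel_def)
  qed (use assms in \<open>auto simp: channel_def\<close>)
  show ?thesis
  proof (intro conjI exI[of _ "1 - C"] allI impI)
    fix \<mu> assume "op_eigenvalue N (T \<circ> Th) \<mu>"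
    hence "op_eigenvalue N \<Lambda> \<mu>" by (simp add: op_eigenvalue_def \<Lambda>_def)
    thus "\<mu> \<in> complex_of_real ` {0 .. 1 - (1 - C)} \<or> \<mu> = 1"
      using op_eigenvalue_\<Lambda>_in_interval by auto
  qed (use fixed_point_iff vn_entropy_gain_contractive in auto)
qed

end
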